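(* Let $\Bbbk$ be an infinite field, let $n, s, d_1, \ldots, d_s$ be fixed positive integers, and let $\preceq$ be a fixed monomial order on the monomials of $S = \Bbbk[x_1,\ldots,x_n]$ with $x_1 \succeq \cdots \succeq x_n$. Then the initial ideal with respect to $\preceq$ of $V$-generic ideals (that is, the common monomial ideal $\operatorname{in}_{\preceq}(I_{\mathbf{a}})$, $\mathbf{a} \in V$) is Borel-fixed.
   Context: Parametrization. $S = \Bbbk[x_1,\ldots,x_n] = \bigoplus_{d\ge 0} S_d$ is graded with $\deg x_i = 1$. Let $r_i = \binom{n+d_i-1}{d_i}$ be the number of monomials of degree $d_i$ in $S$, and $N = \sum_{i=1}^s r_i$. A point $\mathbf{a} = (a_{j,k})_{1\le j\le s,\,1\le k\le r_j} \in \mathbb{A}_{\Bbbk}^N = \Bbbk^N$ corresponds to the homogeneous ideal $I_{\mathbf{a}} = (f_1,\ldots,f_s) \subset S$, where $f_j$ is the linear combination, with coefficients $a_{j,1},\ldots,a_{j,r_j}$, of all monomials of degree $d_j$ (in a fixed enumeration). The set $U$. For each $d \ge 0$ let $t_d = \max_{\mathbf{a}} \dim_{\Bbbk} (I_{\mathbf{a}})_d$ (maximum over all $\mathbf{a}\in\mathbb{A}_{\Bbbk}^N$), let $U_d = \{\mathbf{a} : \dim_{\Bbbk}(I_{\mathbf{a}})_d = t_d\}$, and let $U = \bigcap_{d\ge 0} U_d$. It is known that $U$ is a Zariski open dense subset of $\mathbb{A}_{\Bbbk}^N$. The set $V$ (depending on $\preceq$). For an ideal $I$, $\operatorname{in}_{\preceq}(I)$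 is the ideal spanned over $\Bbbk$ by the initial terms $\operatorname{in}_{\preceq}(f)$, $f \in I$. For each $d$, a standard exterior monomial is an element $m_1\wedge\cdots\wedge m_{t_d}$ of $\bigwedge^{t_d} S_d$ with $m_1 \succ \cdots \succ m_{t_d}$ monomials of degree $d$; these are ordered lexicographically: $m_1\wedge\cdots\wedge m_{t_d} \ge m_1'\wedge\cdots\wedge m_{t_d}'$ iff they are equal or $m_i \succeq m_i'$ for the smallest $i$ with $m_i\ne m_i'$. For $\mathbf{a}\in U_d$, the monomials in $\operatorname{in}_{\preceq}(I_{\mathbf{a}})_d$ form one standard exterior monomial, which spans $\bigwedge^{t_d}\operatorname{in}_{\preceq}(I_{\mathbf{a}})_d$; let $m^{(d)}$ be the largest one obtained as $\mathbf{a}$ ranges over $U_d$. Let $V_d\subset U_d$ be the set of $\mathbf{a} \in U_d$ for which this standard exterior monomial equals $m^{(d)}$, and let $V = \bigcap_{d\ge0} V_d$. It is known that $V \subset U$ is a Zariski open dense subset of $\mathbb{A}_{\Bbbk}^N$; by construction $\operatorname{in}_{\preceq}(I_{\mathbf{a}})$ is the same for all $\mathbf{a}\in V$. The ideals $I_{\mathbf{a}}$ with $\mathbf{a}\in V$ are called $V$-generic ideals. Borel-fixed. $\operatorname{GL}_n(\Bbbk)$ acts on $S$ by $\alpha\cdot f = f(\alpha\cdot x_1,\ldots,\alpha\cdot x_n)$, where $\alpha\cdot x_j = \sum_{i=1}^n \alpha_{i,j}x_i$ for $\alpha = (\alpha_{i,j})$. $\operatorname{B}_n(\Bbbk)$ is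 the subgroup of invertible upper triangular matrices. An ideal $J\subset S$ is Borel-fixed if $\alpha\cdot J = \{\alpha\cdot f : f\in J\}$ equals $J$ for all $\alpha\in \operatorname{B}_n(\Bbbk)$. *)

theory Defs
  imports "HOL-Analysis.Analysis" "HOL-Library.Poly_Mapping"
begin

(* Monomials are exponent vectors.  The variables are indexed by a finite linearly ordered type 'n;
   its elements in increasing order play the role of the indices 1, ..., n, with n = CARD('n). *)
type_synonym 'n monomial = "'n \<Rightarrow>\<^sub>0 nat"

(* The polynomial ring S = k[x_1, ..., x_n], as the monoid algebra on the exponent vectors. *)
type_synonym ('n, 'k) mpoly = "'n monomial \<Rightarrow>\<^sub>0 'k"

definition pscale :: "'k::field \<Rightarrow> ('n, 'k) mpoly \<Rightarrow> ('n, 'k) mpoly" where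
  "pscale c f = Poly_Mapping.single 0 c * f"

lemma vector_space_pscale: "vector_space (pscale :: 'k::field \<Rightarrow> ('n, 'k) mpoly \<Rightarrow> ('n, 'k) mpoly)"
  by unfold_locales
    (simp_all add: pscale_def distrib_left distrib_right single_add mult_single mult.assoc [symmetric])

lemma module_mpoly: "module ((*) :: ('n, 'k::field) mpoly \<Rightarrow> ('n, 'k) mpoly \<Rightarrow> ('n, 'k) mpoly)"
  by unfold_locales (simp_all add: distrib_left distrib_right mult.assoc)

definition xmon :: "'n monomial \<Rightarrow> ('n, 'k::field) mpoly" where
  "xmon m = Poly_Mapping.single m 1"

definition varmon :: "'n \<Rightarrow> 'n monomial" where
  "varmon i = Poly_Mapping.single i 1"

definition mdeg :: "'n::finite monomial \<Rightarrow> nat" where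
  "mdeg m = (\<Sum>i\<in>UNIV. Poly_Mapping.lookup m i)"

definition monomials :: "nat \<Rightarrow> 'n::finite monomial set" where
  "monomials e = {m. mdeg m = e}"

definition homogeneous :: "nat \<Rightarrow> ('n::finite, 'k::field) mpoly set" where
  "homogeneous e = {f. Poly_Mapping.keys f \<subseteq> monomials e}"

definition num_monomials :: "nat \<Rightarrow> nat \<Rightarrow> nat" where
  "num_monomials n e = (n + e - 1) choose e"


section \<open>Ideals, initial ideals\<close>

definition ideal_gen :: "('n, 'k::field) mpoly set \<Rightarrow> ('n, 'k) mpoly set" where
  "ideal_gen F = module.span (*) F"

definition is_ideal :: "('n, 'k::field) mpoly set \<Rightarrow> bool" where
  "is_ideal J \<longleftrightarrow> module.subspace (*) J"

definition graded_part :: "('n::finite, 'k::field) mpoly set \<Rightarrow> nat \<Rightarrow> ('n, 'k) mpoly set" where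
  "graded_part J e = J \<inter> homogeneous e"

(* le u v is to be read as "u is less than or equal to v". *)
definition monomial_order :: "('n monomial \<Rightarrow> 'n monomial \<Rightarrow> bool) \<Rightarrow> bool" where
  "monomial_order le \<longleftrightarrow> linear_order {(u, v). le u v} \<and>
     (\<forall>u v w. le u v \<longrightarrow> le (u + w) (v + w)) \<and> (\<forall>u. le 0 u)"

definition init_mon :: "('n monomial \<Rightarrow> 'n monomial \<Rightarrow> bool) \<Rightarrow> ('n, 'k::field) mpoly \<Rightarrow> 'n monomial" where
  "init_mon le f = (THE m. m \<in> Poly_Mapping.keys f \<and> (\<forall>u\<in>Poly_Mapping.keys f. le u m))"

(* The term includes its coefficient, and the initial term of 0 is 0. *)
definition init_term :: "('n monomial \<Rightarrow> 'n monomial \<Rightarrow> bool) \<Rightarrow> ('n, 'k::field) mpoly \<Rightarrow> ('n, 'k) mpoly" where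
  "init_term le f = (if f = 0 then 0
     else pscale (Poly_Mapping.lookup f (init_mon le f)) (xmon (init_mon le f)))"

definition init_ideal :: "('n monomial \<Rightarrow> 'n monomial \<Rightarrow> bool) \<Rightarrow> ('n, 'k::field) mpoly set \<Rightarrow> ('n, 'k) mpoly set" where
  "init_ideal le J = module.span pscale (init_term le ` J)"


section \<open>The parameter space\<close>

(* Degrees are d 1, ..., d s, and mon j 1, ..., mon j r_j is an enumeration of the monomials
   of degree d j. *)

definition index_set :: "nat \<Rightarrow> nat \<Rightarrow> (nat \<Rightarrow> nat) \<Rightarrow> (nat \<times> nat) set" where
  "index_set n s d = (SIGMA j:{1..s}. {1..num_monomials n (d j)})"

(* The affine space k^N; the coordinate a_{j,k} is a (j, k). *)
definition affine_space :: "nat \<Rightarrow> nat \<Rightarrow> (nat \<Rightarrow> nat) \<Rightarrow> (nat \<times> nat \<Rightarrow> 'k::field) set" where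
  "affine_space n s d = index_set n s d \<rightarrow>\<^sub>E UNIV"

definition is_enumeration :: "nat \<Rightarrow> (nat \<Rightarrow> nat) \<Rightarrow> (nat \<Rightarrow> nat \<Rightarrow> 'n::finite monomial) \<Rightarrow> bool" where
  "is_enumeration s d mon \<longleftrightarrow>
     (\<forall>j\<in>{1..s}. bij_betw (mon j) {1..num_monomials CARD('n) (d j)} (monomials (d j)))"

definition gen_poly ::
  "(nat \<Rightarrow> nat) \<Rightarrow> (nat \<Rightarrow> nat \<Rightarrow> 'n::finite monomial) \<Rightarrow> (nat \<times> nat \<Rightarrow> 'k::field) \<Rightarrow> nat \<Rightarrow> ('n, 'k) mpoly" where
  "gen_poly d mon a j = (\<Sum>k = 1..num_monomials CARD('n) (d j). pscale (a (j, k)) (xmon (mon j k)))"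

definition I_ideal ::
  "nat \<Rightarrow> (nat \<Rightarrow> nat) \<Rightarrow> (nat \<Rightarrow> nat \<Rightarrow> 'n::finite monomial) \<Rightarrow> (nat \<times> nat \<Rightarrow> 'k::field) \<Rightarrow> ('n, 'k) mpoly set" where
  "I_ideal s d mon a = ideal_gen (gen_poly d mon a ` {1..s})"


section \<open>The set U\<close>

definition hilb ::
  "nat \<Rightarrow> (nat \<Rightarrow> nat) \<Rightarrow> (nat \<Rightarrow> nat \<Rightarrow> 'n::finite monomial) \<Rightarrow> nat \<Rightarrow> (nat \<times> nat \<Rightarrow> 'k::field) \<Rightarrow> nat" where
  "hilb s d mon e a = vector_space.dim pscale (graded_part (I_ideal s d mon a) e)"

(* The field enters t_max only through its type, hence the itself argument. *)
definition t_max ::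
  "'k::field itself \<Rightarrow> nat \<Rightarrow> (nat \<Rightarrow> nat) \<Rightarrow> (nat \<Rightarrow> nat \<Rightarrow> 'n::finite monomial) \<Rightarrow> nat \<Rightarrow> nat" where
  "t_max _ s d mon e =
     Max (hilb s d mon e ` (affine_space CARD('n) s d :: (nat \<times> nat \<Rightarrow> 'k) set))"

definition U_deg ::
  "nat \<Rightarrow> (nat \<Rightarrow> nat) \<Rightarrow> (nat \<Rightarrow> nat \<Rightarrow> 'n::finite monomial) \<Rightarrow> nat \<Rightarrow> (nat \<times> nat \<Rightarrow> 'k::field) set" where
  "U_deg s d mon e =
     {a \<in> affine_space CARD('n) s d. hilb s d mon e a = t_max TYPE('k) s d mon e}"

definition U_set ::
  "nat \<Rightarrow> (nat \<Rightarrow> nat) \<Rightarrow> (nat \<Rightarrow> nat \<Rightarrow> 'n::finite monomial) \<Rightarrow> (nat \<times> nat \<Rightarrow> 'k::field) set" where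
  "U_set s d mon = (\<Inter>e. U_deg s d mon e)"


section \<open>Standard exterior monomials and the set V\<close>

(* The standard exterior monomial m_1 \<and> ... \<and> m_t, with m_1, ..., m_t strictly decreasing monomials
   of degree e, is represented by the list of its factors.  This is a faithful encoding because the
   standard exterior monomials form a basis of the t-th exterior power of S_e, indexed by these lists. *)
definition std_ext_monomials ::
  "('n::finite monomial \<Rightarrow> 'n monomial \<Rightarrow> bool) \<Rightarrow> nat \<Rightarrow> nat \<Rightarrow> 'n monomial list set" where
  "std_ext_monomials le t e =
     {ms. length ms = t \<and> set ms \<subseteq> monomials e \<and> sorted_wrt (\<lambda>u v. le v u \<and> u \<noteq> v) ms}"

definition ext_ge ::
  "('n monomial \<Rightarrow> 'n monomial \<Rightarrow> bool) \<Rightarrow> 'n monomial list \<Rightarrow> 'n monomial list \<Rightarrow> bool" where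
  "ext_ge le ms ms' \<longleftrightarrow> ms = ms' \<or>
     (\<exists>i<length ms. ms ! i \<noteq> ms' ! i \<and> (\<forall>j<i. ms ! j = ms' ! j) \<and> le (ms' ! i) (ms ! i))"

(* For a in U_deg s d mon e: the standard exterior monomial formed by the monomials of degree e
   in the initial ideal. *)
definition ext_mon ::
  "('n::finite monomial \<Rightarrow> 'n monomial \<Rightarrow> bool) \<Rightarrow> nat \<Rightarrow> (nat \<Rightarrow> nat) \<Rightarrow> (nat \<Rightarrow> nat \<Rightarrow> 'n monomial) \<Rightarrow>
   nat \<Rightarrow> (nat \<times> nat \<Rightarrow> 'k::field) \<Rightarrow> 'n monomial list" where
  "ext_mon le s d mon e a =
     (THE ms. ms \<in> std_ext_monomials le (t_max TYPE('k) s d mon e) e \<and>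
        set ms = {m. xmon m \<in> graded_part (init_ideal le (I_ideal s d mon a)) e})"

definition max_ext_mon ::
  "'k::field itself \<Rightarrow> ('n::finite monomial \<Rightarrow> 'n monomial \<Rightarrow> bool) \<Rightarrow> nat \<Rightarrow> (nat \<Rightarrow> nat) \<Rightarrow>
   (nat \<Rightarrow> nat \<Rightarrow> 'n monomial) \<Rightarrow> nat \<Rightarrow> 'n monomial list" where
  "max_ext_mon _ le s d mon e =
     (THE M. M \<in> ext_mon le s d mon e ` (U_deg s d mon e :: (nat \<times> nat \<Rightarrow> 'k) set) \<and>
        (\<forall>a\<in>(U_deg s d mon e :: (nat \<times> nat \<Rightarrow> 'k) set). ext_ge le M (ext_mon le s d mon e a)))"

definition V_deg ::
  "('n::finite monomial \<Rightarrow> 'n monomial \<Rightarrow> bool) \<Rightarrow> nat \<Rightarrow> (nat \<Rightarrow> nat) \<Rightarrow> (nat \<Rightarrow> nat \<Rightarrow> 'n monomial) \<Rightarrow>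
   nat \<Rightarrow> (nat \<times> nat \<Rightarrow> 'k::field) set" where
  "V_deg le s d mon e =
     {a \<in> U_deg s d mon e. ext_mon le s d mon e a = max_ext_mon TYPE('k) le s d mon e}"

definition V_set ::
  "('n::finite monomial \<Rightarrow> 'n monomial \<Rightarrow> bool) \<Rightarrow> nat \<Rightarrow> (nat \<Rightarrow> nat) \<Rightarrow> (nat \<Rightarrow> nat \<Rightarrow> 'n monomial) \<Rightarrow>
   (nat \<times> nat \<Rightarrow> 'k::field) set" where
  "V_set le s d mon = (\<Inter>e. V_deg le s d mon e)"


section \<open>Borel-fixed ideals\<close>

definition act_var :: "'k::field ^ 'n::finite ^ 'n \<Rightarrow> 'n \<Rightarrow> ('n, 'k) mpoly" where
  "act_var A j = (\<Sum>i\<in>UNIV. pscale (A $ i $ j) (xmon (varmon i)))"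

(* Substitution of act_var A j for the j-th variable. *)
definition act :: "'k::field ^ 'n::finite ^ 'n \<Rightarrow> ('n, 'k) mpoly \<Rightarrow> ('n, 'k) mpoly" where
  "act A f = (\<Sum>m\<in>Poly_Mapping.keys f.
     pscale (Poly_Mapping.lookup f m) (\<Prod>j\<in>UNIV. act_var A j ^ Poly_Mapping.lookup m j))"

definition borel_group :: "('k::field ^ 'n::{finite, linorder} ^ 'n::{finite, linorder}) set" where
  "borel_group = {A. invertible A \<and> (\<forall>i j. j < i \<longrightarrow> A $ i $ j = 0)}"

definition borel_fixed :: "('n::{finite, linorder}, 'k::field) mpoly set \<Rightarrow> bool" where
  "borel_fixed J \<longleftrightarrow> is_ideal J \<and> (\<forall>A\<in>borel_group. act A ` J = J)"

end

theory Submission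
  imports Defs "Jordan_Normal_Form.Determinant"
begin

text \<open>The family of ideals \<open>I\<^sub>a\<close> is stable under \<open>GL\<^sub>n\<close>, so for \<open>a \<in> V\<close> the exterior monomial of
  \<open>in(g I\<^sub>a)\<^sub>e\<close> never exceeds that of \<open>M = in(I\<^sub>a)\<^sub>e\<close>, for any invertible \<open>g\<close>.  If some
  upper triangular \<open>A\<close> moved \<open>M\<close>, then \<open>A M\<close> would have a strictly larger exterior monomial, because \<open>A\<close>
  only creates larger monomials.  This is transported from \<open>M\<close> to \<open>(I\<^sub>a)\<^sub>e\<close> by \<open>g = A \<delta>\<close> with
  \<open>\<delta> = diag(z\<^bsup>w\<^sub>1\<^esup>, \<dots>, z\<^bsup>w\<^sub>n\<^esup>)\<close>: for weights \<open>w\<close> that separate the relevant monomials, the minors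
  of \<open>A \<delta> f\<^sub>k\<close> are polynomials in \<open>z\<close>, and the coefficient belonging to the product of the initial
  monomials of the \<open>f\<^sub>k\<close> is, up to a nonzero factor, the corresponding minor for \<open>A M\<close>.\<close>

hide_const (open) Determinants.det Finite_Cartesian_Product.mat mon le
no_notation vec_index (infixl "$" 100)

section \<open>Generic minors\<close>

text \<open>That \<open>A\<close> moves \<open>M\<close> does not immediately say anything about the
  ideal itself: the \<open>f_k\<close> have lower terms as well, and what \<open>A\<close> makes of
  these may cancel the new monomials. The minors of \<open>A \<delta> f_k\<close> overcome this.
  Expanding a minor selects one monomial from each \<open>f_k\<close>, and every selection other
  than that of all initial monomials has a strictly smaller product. Hence the product of the
  initial monomials occurs for exactly one selection, and it suffices that the weights separate
  finitely many products; they do not have to represent the order. Its coefficient has to survive,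
  not to lead, so the minor is a nonzero polynomial in \<open>z\<close>, and an infinite field
  offers a value of \<open>z\<close>.

  Exterior powers enter through counting: a nonzero minor of size \<open>r\<close> whose columns are
  monomials at least \<open>l\<close> forces at least \<open>r\<close> initial monomials at least
  \<open>l\<close>. To bound the list of initial monomials from below at each position up to the
  first change, the leading minors of all sizes up to there must be nonzero for the same
  \<open>z\<close>.\<close>

lemma permutes_upt_less: "p permutes {0..<r} \<Longrightarrow> k < r \<Longrightarrow> p k < (r::nat)"
  using permutes_in_image[of p "{0..<r}" k] by simp

text \<open>Leibniz gives products over the rows, and each product expands over choices
  \<open>\<phi>\<close> of one index per row. By \<open>unique\<close>, only \<open>m\<close>
  contributes to the exponent that is its total weight, so this coefficient is the product of the
  \<open>c k (m k)\<close> times the determinant in \<open>det\<close>, both nonzero.\<close>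

lemma det_generic_nonzero:
  fixes c :: "nat \<Rightarrow> 'b \<Rightarrow> 'k::idom" and B :: "nat \<Rightarrow> 'b \<Rightarrow> 'k"
  assumes fin: "finite T" and m: "\<And>k. k < r \<Longrightarrow> m k \<in> T" "\<And>k. k < r \<Longrightarrow> c k (m k) \<noteq> 0"
    and unique: "\<And>\<phi>. \<forall>k<r. \<phi> k \<in> T \<and> c k (\<phi> k) \<noteq> 0 \<Longrightarrow>
      (\<Sum>k<r. w (\<phi> k)) = (\<Sum>k<r. w (m k)) \<Longrightarrow> \<forall>k<r. \<phi> k = m k"
    and det: "Determinant.det (Matrix.mat r r (\<lambda>(k, i). B i (m k))) \<noteq> 0"
  shows "Determinant.det (Matrix.mat r r (\<lambda>(k, i). \<Sum>n\<in>T. monom (c k n * B i n) (w n))) \<noteq> 0"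
proof -
  define W where "W = (\<Sum>k<r. w (m k))"
  define P where "P = Matrix.mat r r (\<lambda>(k, i). \<Sum>n\<in>T. monom (c k n * B i n) (w n))"
  define \<phi>0 where "\<phi>0 = restrict m {..<r}"
  have monoms: "(\<Prod>k\<in>A. monom (f k) (e k)) = monom (\<Prod>k\<in>A. f k) (\<Sum>k\<in>A. e k)"
    for A and f :: "nat \<Rightarrow> 'k" and e
    by (induction A rule: infinite_finite_induct) (auto simp: mult_monom)
  \<comment> \<open>An arbitrary \<open>b\<close> covers every permutation through
    \<open>b k = B (p k)\<close>; the factor in \<open>c\<close> does not depend on \<open>p\<close>
    and leaves the Leibniz sum.\<close>
  have prod_coeff: "coeff (\<Prod>k<r. \<Sum>n\<in>T. monom (c k n * b k n) (w n)) W
      = (\<Prod>k<r. c k (m k)) * (\<Prod>k<r. b k (m k))" for b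
  proof -
    have "(\<Prod>k<r. \<Sum>n\<in>T. monom (c k n * b k n) (w n))
        = (\<Sum>\<phi>\<in>{..<r} \<rightarrow>\<^sub>E T. \<Prod>k<r. monom (c k (\<phi> k) * b k (\<phi> k)) (w (\<phi> k)))"
      by (rule prod_sum_PiE) (auto simp: fin)
    also have "coeff \<dots> W = (\<Sum>\<phi>\<in>{..<r} \<rightarrow>\<^sub>E T.
        if (\<Sum>k<r. w (\<phi> k)) = W then \<Prod>k<r. c k (\<phi> k) * b k (\<phi> k) else 0)"
      by (simp add: coeff_sum monoms)
    also have "\<dots> = (\<Sum>\<phi>\<in>{..<r} \<rightarrow>\<^sub>E T. if \<phi> = \<phi>0 then \<Prod>k<r. c k (\<phi> k) * b k (\<phi> k) else 0)"
    proof (rule sum.cong, goal_cases)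
      case (2 \<phi>)
      show ?case
      proof (cases "\<phi> = \<phi>0")
        case True
        then show ?thesis by (simp add: \<phi>0_def W_def)
      next
        case False
        have "(\<Prod>k<r. c k (\<phi> k) * b k (\<phi> k)) = 0" if *: "(\<Sum>k<r. w (\<phi> k)) = W"
        proof (rule ccontr)
          assume "(\<Prod>k<r. c k (\<phi> k) * b k (\<phi> k)) \<noteq> 0"
          hence "\<forall>k<r. \<phi> k \<in> T \<and> c k (\<phi> k) \<noteq> 0"
            using 2 by (auto simp: PiE_iff)
          from unique[OF this *[unfolded W_def]] have "\<phi> k = m k" if "k < r" for k
            using that by blast
          hence "\<phi> = \<phi>0"
            using 2 by (auto simp: \<phi>0_def PiE_iff extensional_def fun_eq_iff)
          with False show False by simp
        qed
        with False show ?thesis by auto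
      qed
    qed simp
    also have "\<dots> = (\<Prod>k<r. c k (\<phi>0 k) * b k (\<phi>0 k))"
      using m fin by (subst sum.delta) (auto simp: \<phi>0_def intro!: finite_PiE)
    also have "\<dots> = (\<Prod>k<r. c k (m k)) * (\<Prod>k<r. b k (m k))"
      by (simp add: \<phi>0_def prod.distrib)
    finally show ?thesis .
  qed
  have "Determinant.det P = (\<Sum>p | p permutes {0..<r}. signof p *
      (\<Prod>k<r. \<Sum>n\<in>T. monom (c k n * B (p k) n) (w n)))"
    by (subst det_def'[of _ r])
       (auto simp: P_def lessThan_atLeast0 permutes_upt_less intro!: sum.cong prod.cong)
  also have "coeff \<dots> W = (\<Sum>p | p permutes {0..<r}. signof p *
      ((\<Prod>k<r. c k (m k)) * (\<Prod>k<r. B (p k) (m k))))"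
    unfolding coeff_sum by (rule sum.cong) (auto simp: sign_def prod_coeff)
  also have "\<dots> = (\<Prod>k<r. c k (m k)) * Determinant.det (Matrix.mat r r (\<lambda>(k, i). B i (m k)))"
    by (subst det_def'[of _ r])
       (auto simp: sum_distrib_left lessThan_atLeast0 permutes_upt_less mult_ac intro!: sum.cong prod.cong)
  also have "\<dots> \<noteq> 0"
    using det m by auto
  finally show ?thesis
    unfolding P_def[symmetric] by auto
qed

lemma det_eval_monom_matrix:
  fixes c :: "nat \<Rightarrow> 'b \<Rightarrow> 'k::idom"
  shows "poly (Determinant.det (Matrix.mat r r (\<lambda>(k, i). \<Sum>n\<in>T. monom (c k n * B i n) (w n)))) z
    = Determinant.det (Matrix.mat r r (\<lambda>(k, i). \<Sum>n\<in>T. c k n * z ^ w n * B i n))"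
proof -
  interpret comm_ring_hom "\<lambda>p. poly p z" by unfold_locales auto
  show ?thesis
    unfolding hom_det[symmetric]
    by (rule arg_cong[of _ _ Determinant.det], rule eq_matI)
       (auto simp: poly_sum poly_monom mult_ac intro!: sum.cong)
qed

text \<open>Finitely many nonzero polynomials have finitely many roots altogether. Zero is avoided
  too, because powers of \<open>z\<close> become the diagonal entries of an invertible
  matrix.\<close>

lemma infinite_field_common_nonroot:
  fixes P :: "'i \<Rightarrow> 'k::field poly"
  assumes "infinite (UNIV :: 'k set)" "finite I" "\<And>i. i \<in> I \<Longrightarrow> P i \<noteq> 0"
  shows "\<exists>z. z \<noteq> 0 \<and> (\<forall>i\<in>I. poly (P i) z \<noteq> 0)"
proof -
  have "finite ({0} \<union> (\<Union>i\<in>I. {z. poly (P i) z = 0}))"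
    using assms poly_roots_finite by auto
  then obtain z where "z \<notin> {0} \<union> (\<Union>i\<in>I. {z. poly (P i) z = 0})"
    using assms(1) by (meson ex_new_if_finite)
  then show ?thesis by auto
qed

text \<open>Each leading block of the matrix of \<open>B i (m k)\<close> is lower triangular with
  nonzero diagonal, so the minor of every size \<open>r \<le> q\<close> is a nonzero polynomial; one
  \<open>z\<close> then serves all sizes.\<close>

lemma triangular_minors_generic:
  fixes c :: "nat \<Rightarrow> 'b \<Rightarrow> 'k::field" and B :: "nat \<Rightarrow> 'b \<Rightarrow> 'k"
  assumes inf: "infinite (UNIV :: 'k set)"
    and fin: "finite T" and m: "\<And>k. k < q \<Longrightarrow> m k \<in> T" "\<And>k. k < q \<Longrightarrow> c k (m k) \<noteq> 0"
    and unique: "\<And>r \<phi>. r \<le> q \<Longrightarrow> \<forall>k<r. \<phi> k \<in> T \<and> c k (\<phi> k) \<noteq> 0 \<Longrightarrow>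
      (\<Sum>k<r. w (\<phi> k)) = (\<Sum>k<r. w (m k)) \<Longrightarrow> \<forall>k<r. \<phi> k = m k"
    and triangular: "\<And>k i. k < i \<Longrightarrow> i < q \<Longrightarrow> B i (m k) = 0"
      "\<And>k. k < q \<Longrightarrow> B k (m k) \<noteq> 0"
  obtains z where "z \<noteq> 0"
    "\<And>r. r \<le> q \<Longrightarrow> Determinant.det (Matrix.mat r r (\<lambda>(k, i). \<Sum>n\<in>T. c k n * z ^ w n * B i n)) \<noteq> 0"
proof -
  have "\<exists>z. z \<noteq> 0 \<and> (\<forall>r\<in>{..q}.
    poly (Determinant.det (Matrix.mat r r (\<lambda>(k, i). \<Sum>n\<in>T. monom (c k n * B i n) (w n)))) z \<noteq> 0)"
  proof (rule infinite_field_common_nonroot[OF inf], goal_cases)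
    case (2 r)
    then have "r \<le> q" by simp
    have "Determinant.det (Matrix.mat r r (\<lambda>(k, i). B i (m k)))
        = prod_list (diag_mat (Matrix.mat r r (\<lambda>(k, i). B i (m k))))"
      by (rule det_lower_triangular[of r]) (use \<open>r \<le> q\<close> triangular in auto)
    also have "\<dots> \<noteq> 0"
      using \<open>r \<le> q\<close> triangular by (auto simp: prod_list_zero_iff diag_mat_def)
    finally show ?case
      using \<open>r \<le> q\<close> by (intro det_generic_nonzero[where m = m and w = w and c = c and B = B and T = T,
          OF fin m unique[OF \<open>r \<le> q\<close>]]) auto
  qed simp
  with that show ?thesis
    unfolding det_eval_monom_matrix by auto
qed

section \<open>Linear systems and determinants\<close>

lemma det_nonzero_imp_trivial_relation:
  fixes C :: "nat \<Rightarrow> nat \<Rightarrow> 'k::field"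
  assumes "Determinant.det (Matrix.mat r r (\<lambda>(k, i). C k i)) \<noteq> 0"
    and "\<And>i. i < r \<Longrightarrow> (\<Sum>k<r. v k * C k i) = 0" and "k < r"
  shows "v k = 0"
proof (rule ccontr)
  assume "v k \<noteq> 0"
  define M where "M = Matrix.mat r r (\<lambda>(k, i). C k i)"
  have "Matrix.vec r v \<noteq> 0\<^sub>v r"
    using \<open>k < r\<close> \<open>v k \<noteq> 0\<close> by (metis index_vec index_zero_vec(1))
  moreover have "transpose_mat M *\<^sub>v Matrix.vec r v = 0\<^sub>v r"
    using assms(2) by (auto simp: M_def scalar_prod_def lessThan_atLeast0 mult.commute)
  ultimately have "Determinant.det (transpose_mat M) = 0"
    by (subst det_0_iff_vec_prod_zero_field[of _ r]) (auto simp: M_def intro!: exI[of _ "Matrix.vec r v"])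
  then show False
    using assms(1) det_transpose[of M r] by (simp add: M_def)
qed

lemma underdetermined_system:
  fixes E :: "nat \<Rightarrow> 'x \<Rightarrow> 'k::field"
  assumes "finite X" "card X < r"
  obtains v k where "k < r" "v k \<noteq> 0" "\<And>x. x \<in> X \<Longrightarrow> (\<Sum>k<r. v k * E k x) = 0"
proof -
  obtain h where h: "bij_betw h {0..<card X} X"
    using assms(1) ex_bij_betw_nat_finite by blast
  \<comment> \<open>Zero rows pad the system to a square one. Since \<open>card X < r\<close> there
    is at least one, so the determinant vanishes and a kernel vector exists.\<close>
  define M where "M = Matrix.mat r r (\<lambda>(i, k). if i < card X then E k (h i) else 0)"
  have M: "M \<in> carrier_mat r r" by (simp add: M_def)
  have "Determinant.det M = 0"
    using assms(2) by (subst det_def'[OF M], intro sum.neutral)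
      (auto simp: M_def permutes_upt_less intro!: bexI[of _ "card X"])
  then obtain u where u: "u \<in> carrier_vec r" "u \<noteq> 0\<^sub>v r" "M *\<^sub>v u = 0\<^sub>v r"
    using det_0_iff_vec_prod_zero_field[OF M] by auto
  then obtain k where k: "k < r" "vec_index u k \<noteq> 0"
    by (metis carrier_vecD eq_vecI index_zero_vec(1) index_zero_vec(2))
  show ?thesis
  proof (rule that[of k "vec_index u"])
    fix x assume "x \<in> X"
    then obtain i where i: "i < card X" "x = h i"
      using h by (metis atLeastLessThan_iff bij_betw_imp_surj_on imageE)
    with assms have "vec_index (M *\<^sub>v u) i = (\<Sum>k<r. vec_index u k * E k x)"
      using u(1) by (auto simp: M_def scalar_prod_def lessThan_atLeast0 mult.commute intro!: sum.cong)
    then show "(\<Sum>k<r. vec_index u k * E k x) = 0"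
      using u(3) i assms by simp
  qed (use k in auto)
qed

section \<open>The polynomial ring\<close>

interpretation mp: vector_space "pscale :: 'k::field \<Rightarrow> ('n, 'k) mpoly \<Rightarrow> ('n, 'k) mpoly"
  by (rule vector_space_pscale)

lemma lookup_pscale [simp]: "Poly_Mapping.lookup (pscale c f) m = c * Poly_Mapping.lookup f m"
proof -
  have *: "Poly_Mapping.lookup (Poly_Mapping.single 0 c) l * x
      = (c * x when l = 0)" for l and x :: 'a
    by (auto simp: lookup_single when_def)
  show ?thesis
    by (simp add: pscale_def lookup_mult *)
qed

lemma pscale_mult_left: "pscale c f * g = pscale c (f * g)"
  by (simp add: pscale_def mult.assoc)

lemma pscale_mult_right: "f * pscale c g = pscale c (f * g)"
  by (simp add: pscale_def mult.left_commute)

lemma keys_pscale: "Poly_Mapping.keys (pscale c f) \<subseteq> Poly_Mapping.keys f"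
  by (auto simp: in_keys_iff)

lemma lookup_xmon: "Poly_Mapping.lookup (xmon m) u = (if u = m then 1 else 0)"
  by (auto simp: xmon_def lookup_single when_def)

lemma xmon_add: "xmon (u + v) = xmon u * xmon v"
  by (simp add: xmon_def mult_single)

lemma mpoly_eq_sum:
  assumes "finite S" "Poly_Mapping.keys f \<subseteq> S"
  shows "f = (\<Sum>m\<in>S. pscale (Poly_Mapping.lookup f m) (xmon m))"
proof (rule poly_mapping_eqI)
  fix u
  have "(\<Sum>m\<in>S. Poly_Mapping.lookup f m * Poly_Mapping.lookup (xmon m) u)
      = (\<Sum>m\<in>S. if m = u then Poly_Mapping.lookup f u else 0)"
    by (intro sum.cong) (auto simp: lookup_xmon)
  also have "\<dots> = Poly_Mapping.lookup f u"
    using assms by (auto simp: in_keys_iff)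
  finally show "Poly_Mapping.lookup f u
      = Poly_Mapping.lookup (\<Sum>m\<in>S. pscale (Poly_Mapping.lookup f m) (xmon m)) u"
    by (simp add: lookup_sum)
qed

lemma lookup_xmon_mult: "Poly_Mapping.lookup (xmon u * f) (u + m) = Poly_Mapping.lookup f m"
proof -
  have "xmon u * f = (\<Sum>m\<in>Poly_Mapping.keys f. pscale (Poly_Mapping.lookup f m) (xmon (u + m)))"
    by (subst mpoly_eq_sum[of "Poly_Mapping.keys f" f])
       (simp_all add: sum_distrib_left pscale_mult_right xmon_add)
  also have "Poly_Mapping.lookup \<dots> (u + m)
      = (\<Sum>m'\<in>Poly_Mapping.keys f. if m' = m then Poly_Mapping.lookup f m else 0)"
    unfolding lookup_sum by (intro sum.cong) (auto simp: lookup_xmon)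
  also have "\<dots> = Poly_Mapping.lookup f m"
    by (auto simp: in_keys_iff)
  finally show ?thesis .
qed

lemma keys_xmon_mult: "Poly_Mapping.keys (xmon u * f) = (+) u ` Poly_Mapping.keys f"
proof
  show "Poly_Mapping.keys (xmon u * f) \<subseteq> (+) u ` Poly_Mapping.keys f"
    using keys_mult[of "xmon u" f] by (auto simp: xmon_def split: if_splits)
  show "(+) u ` Poly_Mapping.keys f \<subseteq> Poly_Mapping.keys (xmon u * f)"
    by (auto simp: in_keys_iff lookup_xmon_mult)
qed

lemma mdeg_add: "mdeg (u + v) = mdeg u + mdeg v"
  by (simp add: mdeg_def lookup_add sum.distrib)

lemma mdeg_varmon: "mdeg (varmon i) = 1"
  by (simp add: mdeg_def varmon_def lookup_single when_def)

lemma finite_monomials: "finite (monomials e :: 'n::finite monomial set)"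
proof (rule inj_on_finite)
  show "inj_on Poly_Mapping.lookup (monomials e :: 'n monomial set)"
    by (auto intro!: inj_onI poly_mapping_eqI)
  have "Poly_Mapping.lookup m i \<le> e" if "mdeg m = e" for m :: "'n monomial" and i
    using that member_le_sum[of i UNIV "Poly_Mapping.lookup m"] by (auto simp: mdeg_def)
  then show "Poly_Mapping.lookup ` monomials e \<subseteq> (UNIV :: 'n set) \<rightarrow>\<^sub>E {..e}"
    by (auto simp: monomials_def)
  show "finite ((UNIV :: 'n set) \<rightarrow>\<^sub>E {..e})"
    by (intro finite_PiE) auto
qed

lemma subspace_keys_subset: "mp.subspace {f. Poly_Mapping.keys f \<subseteq> M}"
  using keys_add keys_pscale by (intro mp.subspaceI) (simp, fast, fast)

lemma subspace_homogeneous: "mp.subspace (homogeneous e)"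
  unfolding homogeneous_def by (rule subspace_keys_subset)

lemma homogeneous_mult:
  "f \<in> homogeneous d \<Longrightarrow> g \<in> homogeneous e \<Longrightarrow> f * g \<in> homogeneous (d + e)"
  using keys_mult[of f g] by (fastforce simp: homogeneous_def monomials_def mdeg_add)

lemma homogeneous_one: "1 \<in> homogeneous 0"
  by (simp add: homogeneous_def monomials_def mdeg_def)

lemma homogeneous_power: "f \<in> homogeneous d \<Longrightarrow> f ^ k \<in> homogeneous (k * d)"
  by (induction k) (auto intro: homogeneous_one homogeneous_mult)

lemma homogeneous_prod:
  "(\<And>i. i \<in> I \<Longrightarrow> f i \<in> homogeneous (d i)) \<Longrightarrow> (\<Prod>i\<in>I. f i) \<in> homogeneous (\<Sum>i\<in>I. d i)"
  by (induction I rule: infinite_finite_induct) (auto intro: homogeneous_one homogeneous_mult)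

lemma xmon_homogeneous: "xmon m \<in> homogeneous (mdeg m)"
  by (auto simp: homogeneous_def monomials_def xmon_def)

lemma xmon_varmon_power: "xmon (varmon i) ^ k = xmon (Poly_Mapping.single i k)"
  by (induction k) (simp_all add: varmon_def xmon_def mult_single single_add[symmetric])

lemma monomial_eq_sum: "(\<Sum>i\<in>UNIV. Poly_Mapping.single i (Poly_Mapping.lookup m i)) = (m :: 'n::finite monomial)"
  by (rule poly_mapping_eqI) (simp add: lookup_sum lookup_single when_def)

lemma xmon_sum: "xmon (\<Sum>i\<in>I. f i) = (\<Prod>i\<in>I. xmon (f i))"
  by (induction I rule: infinite_finite_induct) (simp_all add: xmon_add, simp_all add: xmon_def)

section \<open>Linear substitutions\<close>

definition act_mon :: "'k::field ^ 'n::finite ^ 'n \<Rightarrow> 'n monomial \<Rightarrow> ('n, 'k) mpoly" where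
  "act_mon A m = (\<Prod>j\<in>UNIV. act_var A j ^ Poly_Mapping.lookup m j)"

lemma act_eq_sum:
  assumes "finite S" "Poly_Mapping.keys f \<subseteq> S"
  shows "act A f = (\<Sum>m\<in>S. pscale (Poly_Mapping.lookup f m) (act_mon A m))"
  unfolding act_def act_mon_def
  by (rule sum.mono_neutral_left) (use assms in \<open>auto simp: in_keys_iff\<close>)

lemma act_add: "act A (f + g) = act A f + act A g"
  using keys_add[of f g]
  by (simp add: act_eq_sum[of "Poly_Mapping.keys f \<union> Poly_Mapping.keys g"]
      lookup_add mp.scale_left_distrib sum.distrib)

lemma act_pscale: "act A (pscale c f) = pscale c (act A f)"
  using keys_pscale[of c f]
  by (simp add: act_eq_sum[of "Poly_Mapping.keys f"] mp.scale_sum_right)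

lemma act_zero [simp]: "act A 0 = 0"
  by (simp add: act_def)

lemma act_sum: "act A (\<Sum>i\<in>I. f i) = (\<Sum>i\<in>I. act A (f i))"
  by (induction I rule: infinite_finite_induct) (simp_all add: act_add)

lemma act_xmon: "act A (xmon m) = act_mon A m"
  by (subst act_eq_sum[of "{m}"]) (auto simp: xmon_def)

lemma act_mon_add: "act_mon A (u + v) = act_mon A u * act_mon A v"
  by (simp add: act_mon_def lookup_add power_add prod.distrib)

lemma act_mult: "act A (f * g) = act A f * act A g"
proof -
  have *: "act A (xmon u * g) = act_mon A u * act A g" for u
    by (subst (1 2) mpoly_eq_sum[of "Poly_Mapping.keys g" g])
       (simp_all add: sum_distrib_left pscale_mult_right act_sum act_pscale xmon_add[symmetric]
         act_xmon act_mon_add)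
  show ?thesis
    by (subst (1 2) mpoly_eq_sum[of "Poly_Mapping.keys f" f])
       (simp_all add: sum_distrib_right pscale_mult_left act_sum act_pscale act_xmon *)
qed

lemma act_one: "act A 1 = 1"
  using act_xmon[of A 0] by (simp add: xmon_def act_mon_def)

lemma act_power: "act A (f ^ k) = act A f ^ k"
  by (induction k) (simp_all add: act_one act_mult)

lemma act_prod: "act A (\<Prod>i\<in>I. f i) = (\<Prod>i\<in>I. act A (f i))"
  by (induction I rule: infinite_finite_induct) (simp_all add: act_one act_mult)

lemma act_xmon_varmon: "act A (xmon (varmon i)) = act_var A i"
proof -
  have "act_var A j ^ Poly_Mapping.lookup (varmon i) j = (if j = i then act_var A i else 1)" for j
    by (simp add: varmon_def lookup_single when_def)
  then show ?thesis
    by (simp add: act_xmon act_mon_def)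
qed

lemma act_act_var: "act A (act_var B j) = act_var (A ** B) j"
proof -
  have "act A (act_var B j) = (\<Sum>i\<in>UNIV. \<Sum>l\<in>UNIV. pscale (B $ i $ j * A $ l $ i) (xmon (varmon l)))"
    by (subst act_var_def) (simp add: act_sum act_pscale act_xmon_varmon act_var_def mp.scale_sum_right)
  also have "\<dots> = act_var (A ** B) j"
    by (subst sum.swap) (simp add: act_var_def matrix_matrix_mult_def mp.scale_sum_left mult.commute)
  finally show ?thesis .
qed

text \<open>The columns of a matrix are the images of the variables, so \<open>act\<close> is a left
  action: in \<open>A ** B\<close> the matrix \<open>B\<close> acts first.\<close>

lemma act_act: "act A (act B f) = act (A ** B) f"
proof -
  have "act A (act_mon B m) = act_mon (A ** B) m" for m
    by (simp add: act_mon_def act_prod act_power act_act_var)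
  then show ?thesis
    by (simp add: act_eq_sum[of "Poly_Mapping.keys f" f] act_sum act_pscale)
qed

lemma pscale_power: "pscale c f ^ k = pscale (c ^ k) (f ^ k)"
  by (induction k) (simp_all add: pscale_mult_left pscale_mult_right)

lemma pscale_prod: "(\<Prod>i\<in>I. pscale (c i) (f i)) = pscale (\<Prod>i\<in>I. c i) (\<Prod>i\<in>I. f i)"
  by (induction I rule: infinite_finite_induct) (simp_all add: pscale_mult_left pscale_mult_right mult_ac)

text \<open>Monomials are eigenvectors of a diagonal substitution. For diagonal entries
  \<open>z ^ w j\<close> the eigenvalue is \<open>z\<close> to the weight of the monomial, which is
  how weights enter.\<close>

lemma act_diag:
  assumes "\<And>i j. A $ i $ j = (if i = j then x j else 0)"
  shows "act_mon A m = pscale (\<Prod>j\<in>UNIV. x j ^ Poly_Mapping.lookup m j) (xmon m)"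
proof -
  have "act_var A j = pscale (x j) (xmon (varmon j))" for j
  proof -
    have "act_var A j = (\<Sum>i\<in>UNIV. if i = j then pscale (x j) (xmon (varmon j)) else 0)"
      unfolding act_var_def assms by (intro sum.cong) auto
    then show ?thesis by simp
  qed
  then show ?thesis
    by (simp add: act_mon_def pscale_power pscale_prod xmon_varmon_power xmon_sum[symmetric] monomial_eq_sum)
qed

lemma act_id:
  fixes f :: "('n::finite, 'k::field) mpoly"
  shows "act (Finite_Cartesian_Product.mat 1) f = f"
proof -
  have "act_mon (Finite_Cartesian_Product.mat 1) m = (xmon m :: ('n, 'k) mpoly)" for m
    by (subst act_diag[where x = "\<lambda>_. 1"]) (auto simp: Finite_Cartesian_Product.mat_def)
  then show ?thesis
    using mpoly_eq_sum[of "Poly_Mapping.keys f" f, symmetric]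
    by (simp add: act_eq_sum[of "Poly_Mapping.keys f" f])
qed

lemma inj_act:
  assumes "invertible A"
  shows "inj (act A)"
proof -
  obtain B where "B ** A = Finite_Cartesian_Product.mat 1"
    using assms by (auto simp: invertible_def)
  then show ?thesis
    by (intro inj_on_inverseI[of _ "act B"]) (simp add: act_act act_id)
qed

lemma act_homogeneous:
  assumes "f \<in> homogeneous e"
  shows "act A f \<in> homogeneous e"
proof -
  have "act_var A j \<in> homogeneous 1" for j
    unfolding act_var_def
    using xmon_homogeneous[of "varmon _"]
    by (intro mp.subspace_sum mp.subspace_scale subspace_homogeneous) (auto simp: mdeg_varmon)
  then have "act_var A j ^ k \<in> homogeneous k" for j k
    using homogeneous_power[of "act_var A j" 1 k] by simp
  then have "act_mon A m \<in> homogeneous (mdeg m)" for m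
    unfolding act_mon_def mdeg_def by (intro homogeneous_prod) auto
  then show ?thesis
    using assms unfolding act_eq_sum[OF finite_keys order.refl]
    by (intro mp.subspace_sum mp.subspace_scale subspace_homogeneous) (auto simp: homogeneous_def monomials_def)
qed

section \<open>Initial monomials\<close>

text \<open>Defined for any set, as it is applied to ideals, to graded pieces and to a set
  difference; \<open>0\<close> is removed because it has no initial monomial.\<close>

definition initials :: "('n monomial \<Rightarrow> 'n monomial \<Rightarrow> bool) \<Rightarrow> ('n, 'k::field) mpoly set \<Rightarrow> 'n monomial set" where
  "initials r W = init_mon r ` (W - {0})"

locale mon_order =
  fixes le :: "'n monomial \<Rightarrow> 'n monomial \<Rightarrow> bool"
  assumes monomial_order: "monomial_order le"
begin

definition lt :: "'n monomial \<Rightarrow> 'n monomial \<Rightarrow> bool" where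
  "lt u v \<longleftrightarrow> le u v \<and> u \<noteq> v"

sublocale ord: linorder le lt
  using monomial_order
  unfolding monomial_order_def linear_order_on_def partial_order_on_def preorder_on_def
    refl_on_def trans_def antisym_def total_on_def
  by unfold_locales (auto simp: lt_def, metis)

lemma le_add_right: "le u v \<Longrightarrow> le (u + w) (v + w)"
  using monomial_order by (auto simp: monomial_order_def)

lemma le_add: "le u v \<Longrightarrow> le u' v' \<Longrightarrow> le (u + u') (v + v')"
  using le_add_right[of u v u'] le_add_right[of u' v' v] ord.order.trans by (simp add: add.commute)

lemma lt_add: "lt u v \<Longrightarrow> le u' v' \<Longrightarrow> lt (u + u') (v + v')"
  using le_add_right[of u v u'] le_add_right[of u' v' v]
  by (metis add.commute add_right_cancel lt_def ord.order.strict_trans2)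

lemma le_sum: "(\<And>i. i \<in> I \<Longrightarrow> le (f i) (g i)) \<Longrightarrow> le (\<Sum>i\<in>I. f i) (\<Sum>i\<in>I. g i)"
  by (induction I rule: infinite_finite_induct) (simp_all add: le_add)

text \<open>The source of uniqueness in the expansion of a minor: a strict inequality in one factor
  survives multiplication by the other factors.\<close>

lemma sum_eq_imp_eq:
  assumes "finite I" "\<And>i. i \<in> I \<Longrightarrow> le (f i) (g i)" "(\<Sum>i\<in>I. f i) = (\<Sum>i\<in>I. g i)" "i \<in> I"
  shows "f i = g i"
proof (rule ccontr)
  assume "f i \<noteq> g i"
  then have "lt (f i + (\<Sum>i\<in>I - {i}. f i)) (g i + (\<Sum>i\<in>I - {i}. g i))"
    using assms by (intro lt_add le_sum) (auto simp: lt_def)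
  then show False
    using assms by (simp add: sum.remove[symmetric])
qed

lemma init_mon_props:
  assumes "f \<noteq> 0"
  shows "init_mon le f \<in> Poly_Mapping.keys f"
    and "u \<in> Poly_Mapping.keys f \<Longrightarrow> le u (init_mon le f)"
proof -
  have *: "finite (Poly_Mapping.keys f)" "Poly_Mapping.keys f \<noteq> {}"
    using assms by auto
  have "init_mon le f \<in> Poly_Mapping.keys f \<and> (\<forall>u\<in>Poly_Mapping.keys f. le u (init_mon le f))"
    unfolding init_mon_def
    by (rule theI[where a = "ord.Max (Poly_Mapping.keys f)"])
       (use * in \<open>auto intro: ord.order.antisym\<close>)
  then show "init_mon le f \<in> Poly_Mapping.keys f"
    "u \<in> Poly_Mapping.keys f \<Longrightarrow> le u (init_mon le f)" by auto
qed

lemma init_mon_eqI: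
  assumes "m \<in> Poly_Mapping.keys f" "\<And>u. u \<in> Poly_Mapping.keys f \<Longrightarrow> le u m"
  shows "init_mon le f = m"
  using assms init_mon_props[of f] by (metis keys_zero empty_iff ord.order.antisym)

lemma init_mon_xmon_mult:
  assumes "f \<noteq> 0"
  shows "xmon u * f \<noteq> 0" "init_mon le (xmon u * f) = u + init_mon le f"
proof -
  have "u + init_mon le f \<in> Poly_Mapping.keys (xmon u * f)"
    using init_mon_props[OF assms] by (auto simp: keys_xmon_mult)
  then show "xmon u * f \<noteq> 0" by auto
  show "init_mon le (xmon u * f) = u + init_mon le f"
    using init_mon_props[OF assms]
    by (intro init_mon_eqI) (auto simp: keys_xmon_mult intro!: le_add)
qed

lemma initialsE:
  assumes "m \<in> initials le W"
  obtains f where "f \<in> W" "f \<noteq> 0" "init_mon le f = m"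
  using assms by (auto simp: initials_def)

lemma initialsI: "f \<in> W \<Longrightarrow> f \<noteq> 0 \<Longrightarrow> init_mon le f \<in> initials le W"
  by (auto simp: initials_def)

text \<open>Leading coefficients are invertible, so initial terms and initial monomials span the
  same space. Questions about the initial ideal thereby become questions about the set
  \<open>initials le J\<close>.\<close>

lemma init_ideal_eq:
  assumes "mp.subspace J"
  shows "init_ideal le J = {f. Poly_Mapping.keys f \<subseteq> initials le J}"
proof
  have "init_term le f \<in> {f. Poly_Mapping.keys f \<subseteq> initials le J}" if "f \<in> J" for f
    using that keys_pscale[of "Poly_Mapping.lookup f (init_mon le f)" "xmon (init_mon le f)"]
    by (auto simp: init_term_def xmon_def initialsI split: if_splits)
  then show "init_ideal le J \<subseteq> {f. Poly_Mapping.keys f \<subseteq> initials le J}"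
    unfolding init_ideal_def by (intro mp.span_minimal subspace_keys_subset) auto
  have "xmon m \<in> init_ideal le J" if m: "m \<in> initials le J" for m
  proof -
    obtain f where f: "f \<in> J" "f \<noteq> 0" "init_mon le f = m"
      using m by (rule initialsE)
    let ?c = "Poly_Mapping.lookup f m"
    have "?c \<noteq> 0"
      using f init_mon_props(1)[of f] by (auto simp: in_keys_iff)
    then have "xmon m = pscale (inverse ?c) (init_term le f)"
      using f by (simp add: init_term_def)
    then show ?thesis
      using f unfolding init_ideal_def by (metis image_eqI mp.span_base mp.span_scale)
  qed
  then have "f \<in> init_ideal le J" if "Poly_Mapping.keys f \<subseteq> initials le J" for f
    using that unfolding init_ideal_def
    by (subst mpoly_eq_sum[of "Poly_Mapping.keys f" f])
       (auto intro!: mp.span_sum mp.span_scale)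
  then show "{f. Poly_Mapping.keys f \<subseteq> initials le J} \<subseteq> init_ideal le J" by auto
qed

end

section \<open>Counting initial monomials of homogeneous subspaces\<close>

locale graded_mon_order = mon_order le
  for le :: "'n::finite monomial \<Rightarrow> 'n monomial \<Rightarrow> bool"
begin

lemma initials_homogeneous: "W \<subseteq> homogeneous e \<Longrightarrow> initials le W \<subseteq> monomials e"
  using init_mon_props(1) by (fastforce simp: initials_def homogeneous_def)

lemma finite_initials: "W \<subseteq> homogeneous e \<Longrightarrow> finite (initials le W)"
  using initials_homogeneous finite_monomials by (rule finite_subset)

text \<open>One element of \<open>W\<close> per initial monomial gives a basis. A relation fails at
  its largest initial monomial; an element outside the span can be reduced to a smaller initial
  monomial, and a least one exists because degree \<open>e\<close> has finitely many
  monomials.\<close>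

lemma card_initials:
  fixes W :: "('n, 'k::field) mpoly set"
  assumes sub: "mp.subspace W" and hom: "W \<subseteq> homogeneous e"
  shows "card (initials le W) = mp.dim W"
proof -
  have "\<forall>m\<in>initials le W. \<exists>f. f \<in> W \<and> f \<noteq> 0 \<and> init_mon le f = m"
    by (auto elim: initialsE)
  then obtain F where F: "F m \<in> W" "F m \<noteq> 0" "init_mon le (F m) = m" if "m \<in> initials le W" for m
    by metis
  let ?M = "initials le W"
  have fin: "finite ?M" by (rule finite_initials[OF hom])
  have inj: "inj_on F ?M"
    using F(3) by (rule inj_on_inverseI)
  have lookup_F: "Poly_Mapping.lookup (F m) u = 0" if "m \<in> ?M" "lt m u" for m u
    using that F init_mon_props(2)[of "F m" u] by (metis in_keys_iff ord.leD)
  have lookup_F_init: "Poly_Mapping.lookup (F m) m \<noteq> 0" if "m \<in> ?M" for m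
    using that F init_mon_props(1)[of "F m"] by (metis in_keys_iff)
  have "mp.independent (F ` ?M)"
  proof (rule mp.independent_if_scalars_zero)
    fix c f assume *: "(\<Sum>x\<in>F ` ?M. pscale (c x) x) = 0" "f \<in> F ` ?M"
    show "c f = 0"
    proof (rule ccontr)
      assume "c f \<noteq> 0"
      define N where "N = {m \<in> ?M. c (F m) \<noteq> 0}"
      have N: "finite N" "N \<noteq> {}" using fin *(2) \<open>c f \<noteq> 0\<close> by (auto simp: N_def)
      define m where "m = ord.Max N"
      have m: "m \<in> N" "\<And>u. u \<in> N \<Longrightarrow> le u m" using N by (auto simp: m_def)
      have "0 = Poly_Mapping.lookup (\<Sum>u\<in>?M. pscale (c (F u)) (F u)) m"
        using * inj by (simp add: sum.reindex)
      also have "\<dots> = (\<Sum>u\<in>?M. if u = m then c (F m) * Poly_Mapping.lookup (F m) m else 0)"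
        unfolding lookup_sum
      proof (intro sum.cong refl)
        fix u assume "u \<in> ?M"
        then show "Poly_Mapping.lookup (pscale (c (F u)) (F u)) m =
            (if u = m then c (F m) * Poly_Mapping.lookup (F m) m else 0)"
          using m(2)[of u] lookup_F[of u m] by (auto simp: N_def lt_def)
      qed
      also have "\<dots> \<noteq> 0"
        using fin m(1) lookup_F_init by (auto simp: N_def)
      finally show False by simp
    qed
  qed (use fin in auto)
  moreover have "W \<subseteq> mp.span (F ` ?M)"
  proof (rule ccontr)
    assume not_sub: "\<not> W \<subseteq> mp.span (F ` ?M)"
    define N where "N = initials le (W - mp.span (F ` ?M))"
    have "N \<noteq> {}"
      using not_sub mp.span_zero by (auto simp: N_def initials_def)
    moreover have "finite N"
      unfolding N_def by (rule finite_initials[of _ e]) (use hom in auto)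
    ultimately have m: "ord.Min N \<in> N" "\<And>u. u \<in> N \<Longrightarrow> le (ord.Min N) u"
      by auto
    define m where "m = ord.Min N"
    obtain f where f: "f \<in> W" "f \<notin> mp.span (F ` ?M)" "f \<noteq> 0" "init_mon le f = m"
      using m(1) unfolding m_def[symmetric] by (auto simp: N_def elim: initialsE)
    then have "m \<in> ?M" by (auto simp: initials_def)
    \<comment> \<open>The terms at \<open>m\<close> cancel, which would push the initial monomial of
      \<open>g\<close> below the minimum of \<open>N\<close>.\<close>
    define g where "g = f - pscale (Poly_Mapping.lookup f m / Poly_Mapping.lookup (F m) m) (F m)"
    have "g \<in> W"
      unfolding g_def using f F[OF \<open>m \<in> ?M\<close>] sub by (intro mp.subspace_diff mp.subspace_scale) auto
    have "g \<notin> mp.span (F ` ?M)"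
    proof
      assume "g \<in> mp.span (F ` ?M)"
      moreover have "pscale (Poly_Mapping.lookup f m / Poly_Mapping.lookup (F m) m) (F m)
          \<in> mp.span (F ` ?M)"
        using \<open>m \<in> ?M\<close> by (intro mp.span_scale mp.span_base) auto
      ultimately have "g + pscale (Poly_Mapping.lookup f m / Poly_Mapping.lookup (F m) m) (F m)
          \<in> mp.span (F ` ?M)"
        by (rule mp.span_add)
      then show False using f by (simp add: g_def)
    qed
    then have "g \<noteq> 0" using mp.span_zero by blast
    have "init_mon le g \<in> N"
      using \<open>g \<in> W\<close> \<open>g \<notin> _\<close> \<open>g \<noteq> 0\<close> by (auto simp: N_def intro!: initialsI)
    then have "le m (init_mon le g)" using m m_def by blast
    moreover have "u \<notin> Poly_Mapping.keys g" if "le m u" for u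
    proof (cases "u = m")
      case True
      then show ?thesis using lookup_F_init[OF \<open>m \<in> ?M\<close>] by (simp add: g_def in_keys_iff lookup_minus)
    next
      case False
      with that have "lt m u" by (auto simp: lt_def)
      then have "Poly_Mapping.lookup f u = 0"
        using f init_mon_props(2)[of f u] by (metis in_keys_iff ord.leD)
      then show ?thesis
        using lookup_F[OF \<open>m \<in> ?M\<close> \<open>lt m u\<close>] by (simp add: g_def in_keys_iff lookup_minus)
    qed
    ultimately show False using init_mon_props(1)[OF \<open>g \<noteq> 0\<close>] by blast
  qed
  ultimately have "card (F ` ?M) = mp.dim W"
    using F by (intro mp.basis_card_eq_dim) auto
  then show ?thesis
    using inj by (simp add: card_image)
qed

text \<open>With fewer than \<open>r\<close> initial monomials at least \<open>l0\<close>, some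
  nontrivial combination of the \<open>h k\<close> vanishes at all of them. The nonzero minor makes
  it nonzero at some \<open>l i\<close>, so its own initial monomial is at least \<open>l0\<close>
  and is one of those where it vanishes.\<close>

lemma minor_nonzero_imp_initials_ge:
  fixes W :: "('n, 'k::field) mpoly set"
  assumes sub: "mp.subspace W" and hom: "W \<subseteq> homogeneous e"
    and h: "\<And>k. k < r \<Longrightarrow> h k \<in> W"
    and det: "Determinant.det (Matrix.mat r r (\<lambda>(k, i). Poly_Mapping.lookup (h k) (l i))) \<noteq> 0"
    and l: "\<And>i. i < r \<Longrightarrow> le l0 (l i)"
  shows "r \<le> card {x \<in> initials le W. le l0 x}"
proof (rule ccontr)
  let ?X = "{x \<in> initials le W. le l0 x}"
  assume "\<not> ?thesis"
  then have "card ?X < r" by simp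
  with finite_initials[OF hom] obtain v k where v: "k < r" "v k \<noteq> 0"
    "\<And>x. x \<in> ?X \<Longrightarrow> (\<Sum>k<r. v k * Poly_Mapping.lookup (h k) x) = 0"
    by (rule_tac underdetermined_system[of ?X r "\<lambda>k. Poly_Mapping.lookup (h k)"]) auto
  define f where "f = (\<Sum>k<r. pscale (v k) (h k))"
  have lookup_f: "Poly_Mapping.lookup f x = (\<Sum>k<r. v k * Poly_Mapping.lookup (h k) x)" for x
    by (simp add: f_def lookup_sum)
  have "f \<in> W"
    unfolding f_def using h sub by (intro mp.subspace_sum mp.subspace_scale) auto
  obtain i where i: "i < r" "Poly_Mapping.lookup f (l i) \<noteq> 0"
    using det_nonzero_imp_trivial_relation[OF det, of v k] v(1,2) lookup_f by metis
  then have "f \<noteq> 0" by auto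
  have "le l0 (init_mon le f)"
    using init_mon_props(2)[OF \<open>f \<noteq> 0\<close>, of "l i"] i l[of i] ord.order.trans by (auto simp: in_keys_iff)
  then have "init_mon le f \<in> ?X"
    using \<open>f \<in> W\<close> \<open>f \<noteq> 0\<close> by (auto intro: initialsI)
  then have "Poly_Mapping.lookup f (init_mon le f) = 0"
    using v(3) lookup_f by simp
  then show False
    using init_mon_props(1)[OF \<open>f \<noteq> 0\<close>] by auto
qed

end

section \<open>Homogeneous ideals\<close>

interpretation mpi: Modules.module "(*) :: ('n, 'k::field) mpoly \<Rightarrow> ('n, 'k) mpoly \<Rightarrow> ('n, 'k) mpoly"
  by (rule module_mpoly)

lemma is_ideal_ideal_gen: "is_ideal (ideal_gen F)"
  by (simp add: is_ideal_def ideal_gen_def mpi.subspace_span)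

lemma is_ideal_mult: "is_ideal J \<Longrightarrow> f \<in> J \<Longrightarrow> g * f \<in> J"
  unfolding is_ideal_def by (rule mpi.subspace_scale)

lemma is_ideal_subspace: "is_ideal J \<Longrightarrow> mp.subspace J"
  unfolding is_ideal_def
  by (rule mp.subspaceI) (simp_all add: pscale_def mpi.subspace_0 mpi.subspace_add mpi.subspace_scale)

definition hom_comp :: "nat \<Rightarrow> ('n::finite, 'k::field) mpoly \<Rightarrow> ('n, 'k) mpoly" where
  "hom_comp e f = (\<Sum>m\<in>Poly_Mapping.keys f \<inter> monomials e. pscale (Poly_Mapping.lookup f m) (xmon m))"

lemma lookup_hom_comp:
  "Poly_Mapping.lookup (hom_comp e f) m = (if m \<in> monomials e then Poly_Mapping.lookup f m else 0)"
proof -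
  have "Poly_Mapping.lookup (hom_comp e f) m = (\<Sum>u\<in>Poly_Mapping.keys f \<inter> monomials e.
      if u = m then Poly_Mapping.lookup f m else 0)"
    unfolding hom_comp_def lookup_sum by (intro sum.cong) (auto simp: lookup_xmon)
  then show ?thesis by (auto simp: in_keys_iff)
qed

lemma hom_comp_homogeneous: "hom_comp e f \<in> homogeneous e"
  by (auto simp: homogeneous_def in_keys_iff lookup_hom_comp split: if_splits)

lemma hom_comp_add: "hom_comp e (f + g) = hom_comp e f + hom_comp e g"
  by (rule poly_mapping_eqI) (simp add: lookup_hom_comp lookup_add)

lemma hom_comp_pscale: "hom_comp e (pscale c f) = pscale c (hom_comp e f)"
  by (rule poly_mapping_eqI) (simp add: lookup_hom_comp)

lemma hom_comp_zero: "hom_comp e 0 = 0"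
  by (simp add: hom_comp_def)

lemma hom_comp_sum: "hom_comp e (\<Sum>i\<in>I. f i) = (\<Sum>i\<in>I. hom_comp e (f i))"
  by (induction I rule: infinite_finite_induct) (simp_all add: hom_comp_add hom_comp_zero)

lemma hom_comp_of_homogeneous:
  "f \<in> homogeneous d \<Longrightarrow> hom_comp e f = (if d = e then f else 0)"
  by (rule poly_mapping_eqI)
     (auto simp: lookup_hom_comp homogeneous_def monomials_def in_keys_iff subset_iff)

definition homogeneous_ideal :: "('n::finite, 'k::field) mpoly set \<Rightarrow> bool" where
  "homogeneous_ideal J \<longleftrightarrow> is_ideal J \<and> (\<forall>f\<in>J. \<forall>e. hom_comp e f \<in> J)"

text \<open>Splitting the multiplier into monomials leaves products \<open>xmon u * x\<close> with
  \<open>x\<close> homogeneous; such a product is its own component in one degree and has component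
  \<open>0\<close> in all others.\<close>

lemma homogeneous_ideal_gen:
  assumes "\<And>f. f \<in> F \<Longrightarrow> \<exists>d. f \<in> homogeneous d"
  shows "homogeneous_ideal (ideal_gen F)"
  unfolding homogeneous_ideal_def
proof (intro conjI ballI allI is_ideal_ideal_gen)
  fix f e assume "f \<in> ideal_gen F"
  note sub = is_ideal_subspace[OF is_ideal_ideal_gen[of F]]
  show "hom_comp e f \<in> ideal_gen F"
    using \<open>f \<in> ideal_gen F\<close> unfolding ideal_gen_def
  proof (induction rule: mpi.span_induct_alt)
    case base
    then show ?case by (simp add: hom_comp_zero mpi.span_zero)
  next
    case (step c x y)
    obtain d where d: "x \<in> homogeneous d" using assms step by blast
    have "x \<in> ideal_gen F" using step by (simp add: ideal_gen_def mpi.span_base)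
    have "hom_comp e (xmon u * x) \<in> ideal_gen F" for u
      using hom_comp_of_homogeneous[OF homogeneous_mult[OF xmon_homogeneous[of u] d], of e]
        is_ideal_mult[OF is_ideal_ideal_gen \<open>x \<in> ideal_gen F\<close>] mp.subspace_0[OF sub] by auto
    then have "hom_comp e (c * x) \<in> ideal_gen F"
      using sub by (subst mpoly_eq_sum[of "Poly_Mapping.keys c" c])
        (auto simp: sum_distrib_right hom_comp_sum pscale_mult_left hom_comp_pscale
          intro!: mp.subspace_sum mp.subspace_scale)
    then show ?case
      using step by (simp add: hom_comp_add ideal_gen_def mpi.span_add)
  qed
qed

lemma graded_part_subspace: "is_ideal J \<Longrightarrow> mp.subspace (graded_part J e)"
  unfolding graded_part_def by (intro mp.subspace_inter is_ideal_subspace subspace_homogeneous)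

lemma graded_part_homogeneous: "graded_part J e \<subseteq> homogeneous e"
  by (simp add: graded_part_def)

context graded_mon_order
begin

text \<open>If the initial monomial of \<open>f\<close> has degree \<open>e\<close>, the component
  of degree \<open>e\<close> keeps it and gains no other monomials. This allows passing from the
  ideal to one finite-dimensional degree.\<close>

lemma initials_graded_part:
  assumes J: "homogeneous_ideal J"
  shows "initials le (graded_part J e) = initials le J \<inter> monomials e"
proof
  show "initials le (graded_part J e) \<subseteq> initials le J \<inter> monomials e"
    using initials_homogeneous[OF graded_part_homogeneous[of J e]]
    by (auto simp: initials_def graded_part_def)
  show "initials le J \<inter> monomials e \<subseteq> initials le (graded_part J e)"
  proof
    fix m assume m: "m \<in> initials le J \<inter> monomials e"
    then obtain f where f: "f \<in> J" "f \<noteq> 0" "init_mon le f = m"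
      by (auto elim: initialsE)
    have "init_mon le (hom_comp e f) = m"
      using m f(3) init_mon_props[OF f(2)]
      by (intro init_mon_eqI) (auto simp: in_keys_iff lookup_hom_comp split: if_splits)
    moreover have "Poly_Mapping.lookup (hom_comp e f) m \<noteq> 0"
      using m f(3) init_mon_props[OF f(2)] by (auto simp: in_keys_iff lookup_hom_comp)
    then have "hom_comp e f \<noteq> 0" by auto
    moreover have "hom_comp e f \<in> graded_part J e"
      using J f hom_comp_homogeneous by (auto simp: graded_part_def homogeneous_ideal_def)
    ultimately show "m \<in> initials le (graded_part J e)"
      by (metis initialsI)
  qed
qed

text \<open>Connects the set of monomials in the definition of \<open>ext_mon\<close> with
  \<open>initials\<close>, for which the counting results hold.\<close>

lemma graded_init_ideal_monomials:
  assumes J: "homogeneous_ideal J"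
  shows "{m. xmon m \<in> graded_part (init_ideal le J) e} = initials le (graded_part J e)"
proof -
  have "mp.subspace J"
    using J by (simp add: homogeneous_ideal_def is_ideal_subspace)
  then show ?thesis
    unfolding initials_graded_part[OF J]
    by (auto simp: init_ideal_eq graded_part_def homogeneous_def xmon_def)
qed

text \<open>Multiplying by a monomial shifts the initial monomial, so \<open>initials le J\<close>
  absorbs sums of exponents, and so does the space of polynomials supported on it absorb
  products.\<close>

lemma is_ideal_init_ideal:
  assumes J: "is_ideal J"
  shows "is_ideal (init_ideal le J)"
proof -
  note sub = is_ideal_subspace[OF J]
  have closed: "u + m \<in> initials le J" if "m \<in> initials le J" for u m
  proof -
    obtain f where f: "f \<in> J" "f \<noteq> 0" "init_mon le f = m"
      using \<open>m \<in> initials le J\<close> by (rule initialsE)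
    then show ?thesis
      using init_mon_xmon_mult[OF f(2), of u] initialsI[OF is_ideal_mult[OF J f(1)], of "xmon u"] by simp
  qed
  have "g * f \<in> init_ideal le J" if "f \<in> init_ideal le J" for f g
    using that closed keys_mult[of g f] unfolding init_ideal_eq[OF sub] by blast
  moreover have "mp.subspace (init_ideal le J)"
    unfolding init_ideal_eq[OF sub] by (rule subspace_keys_subset)
  ultimately show ?thesis
    by (simp add: is_ideal_def mpi.subspace_def mp.subspace_0 mp.subspace_add)
qed

end

section \<open>The action on the ideals of the family\<close>

lemma act_ideal_gen_subset: "act A ` ideal_gen F \<subseteq> ideal_gen (act A ` F)"
proof
  fix g assume "g \<in> act A ` ideal_gen F"
  then obtain f where f: "f \<in> ideal_gen F" "g = act A f" by auto
  have "act A f \<in> mpi.span (act A ` F)"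
    using f(1) unfolding ideal_gen_def
  proof (induction rule: mpi.span_induct_alt)
    case base
    then show ?case by (simp add: mpi.span_zero)
  next
    case (step c x y)
    then show ?case
      by (auto simp: act_add act_mult intro!: mpi.span_add mpi.span_scale intro: mpi.span_base)
  qed
  then show "g \<in> ideal_gen (act A ` F)" using f by (simp add: ideal_gen_def)
qed

text \<open>The reverse inclusion is the forward one for the inverse matrix.\<close>

lemma act_ideal_gen:
  assumes "invertible A"
  shows "act A ` ideal_gen F = ideal_gen (act A ` F)"
proof
  obtain B where B: "B ** A = Finite_Cartesian_Product.mat 1" "A ** B = Finite_Cartesian_Product.mat 1"
    using assms by (auto simp: invertible_def)
  show "ideal_gen (act A ` F) \<subseteq> act A ` ideal_gen F"
  proof
    fix f assume "f \<in> ideal_gen (act A ` F)"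
    then have "act B f \<in> ideal_gen (act B ` act A ` F)"
      using act_ideal_gen_subset[of B] by blast
    then have "act B f \<in> ideal_gen F"
      by (simp add: image_image act_act B act_id)
    then have "act A (act B f) \<in> act A ` ideal_gen F" by blast
    then show "f \<in> act A ` ideal_gen F" by (simp add: act_act B act_id)
  qed
qed (rule act_ideal_gen_subset)

lemma act_graded_part:
  assumes "invertible A"
  shows "graded_part (act A ` J) e = act A ` graded_part J e"
proof -
  obtain B where B: "B ** A = Finite_Cartesian_Product.mat 1"
    using assms by (auto simp: invertible_def)
  have "f \<in> homogeneous e" if "act A f \<in> homogeneous e" for f
    using act_homogeneous[OF that, of B] by (simp add: act_act B act_id)
  then show ?thesis
    unfolding graded_part_def using act_homogeneous by blast
qed

lemma linear_act: "Vector_Spaces.linear pscale pscale (act A)"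
  by unfold_locales (simp_all add: act_add act_pscale)

lemma subspace_act_image: "mp.subspace W \<Longrightarrow> mp.subspace (act A ` W)"
  using Vector_Spaces.linear.axioms(3)[OF linear_act]
  by (rule module_hom.subspace_image)

lemma dim_act_image:
  assumes "invertible A"
  shows "mp.dim (act A ` W) = mp.dim W"
proof -
  interpret lin: Vector_Spaces.linear pscale pscale "act A" by (rule linear_act)
  obtain B where B: "B \<subseteq> W" "mp.independent B" "W \<subseteq> mp.span B" "card B = mp.dim W"
    by (rule mp.basis_exists)
  show ?thesis
  proof (rule mp.dim_unique)
    show "act A ` W \<subseteq> mp.span (act A ` B)" using B by (auto simp: lin.span_image)
    show "mp.independent (act A ` B)" by (rule lin.independent_inj_image[OF B(2) inj_act[OF assms]])
    show "card (act A ` B) = mp.dim W"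
      using B(4) inj_act[OF assms] by (metis card_image inj_on_subset subset_UNIV)
  qed (use B in auto)
qed

section \<open>Parameter points for transformed ideals\<close>

lemma gen_poly_homogeneous:
  fixes mon :: "nat \<Rightarrow> nat \<Rightarrow> 'n::finite monomial"
  assumes "is_enumeration s d mon" "j \<in> {1..s}"
  shows "gen_poly d mon a j \<in> homogeneous (d j)"
proof -
  have "xmon (mon j k) \<in> homogeneous (d j)" if "k \<in> {1..num_monomials CARD('n) (d j)}" for k
  proof -
    have "mon j k \<in> monomials (d j)"
      using that assms bij_betwE[of "mon j"] unfolding is_enumeration_def by blast
    then show ?thesis
      using xmon_homogeneous[of "mon j k"] by (simp add: monomials_def)
  qed
  then show ?thesis
    unfolding gen_poly_def by (intro mp.subspace_sum mp.subspace_scale subspace_homogeneous)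
qed

lemma homogeneous_ideal_I_ideal:
  assumes "is_enumeration s d mon"
  shows "homogeneous_ideal (I_ideal s d mon a)"
  unfolding I_ideal_def
proof (rule homogeneous_ideal_gen)
  fix f assume "f \<in> gen_poly d mon a ` {1..s}"
  then obtain j where "j \<in> {1..s}" "f = gen_poly d mon a j" by auto
  then show "\<exists>e. f \<in> homogeneous e"
    using gen_poly_homogeneous[OF assms] by (intro exI[of _ "d j"]) simp
qed

text \<open>The parameter space reaches every tuple of forms of the prescribed degrees, since the
  enumeration lists all monomials. This is why a substitution cannot lead out of the family.\<close>

lemma gen_poly_surj:
  fixes h :: "nat \<Rightarrow> ('n::finite, 'k::field) mpoly"
  assumes "is_enumeration s d mon" "\<And>j. j \<in> {1..s} \<Longrightarrow> h j \<in> homogeneous (d j)"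
  obtains a where "a \<in> affine_space CARD('n) s d" "\<And>j. j \<in> {1..s} \<Longrightarrow> gen_poly d mon a j = h j"
proof
  define a where "a = (\<lambda>(j, k)\<in>index_set CARD('n) s d. Poly_Mapping.lookup (h j) (mon j k))"
  show "a \<in> affine_space CARD('n) s d"
    by (auto simp: a_def affine_space_def)
  fix j assume j: "j \<in> {1..s}"
  have "gen_poly d mon a j = (\<Sum>k = 1..num_monomials CARD('n) (d j).
      pscale (Poly_Mapping.lookup (h j) (mon j k)) (xmon (mon j k)))"
    unfolding gen_poly_def by (rule sum.cong) (use j in \<open>auto simp: a_def index_set_def\<close>)
  also have "\<dots> = (\<Sum>m\<in>monomials (d j). pscale (Poly_Mapping.lookup (h j) m) (xmon m))"
    using assms(1) j by (intro sum.reindex_bij_betw) (auto simp: is_enumeration_def)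
  also have "\<dots> = h j"
    using assms(2)[OF j] finite_monomials by (intro mpoly_eq_sum[symmetric]) (auto simp: homogeneous_def)
  finally show "gen_poly d mon a j = h j" .
qed

lemma act_I_ideal:
  fixes A :: "'k::field ^ 'n::finite ^ 'n"
  assumes "is_enumeration s d mon" "invertible A"
  obtains b where "b \<in> affine_space CARD('n) s d" "I_ideal s d mon b = act A ` I_ideal s d mon a"
proof -
  obtain b where b: "b \<in> affine_space CARD('n) s d"
    "\<And>j. j \<in> {1..s} \<Longrightarrow> gen_poly d mon b j = act A (gen_poly d mon a j)"
    using gen_poly_surj[OF assms(1), of "\<lambda>j. act A (gen_poly d mon a j)"]
      act_homogeneous gen_poly_homogeneous[OF assms(1)] by blast
  then have "I_ideal s d mon b = act A ` I_ideal s d mon a"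
    unfolding I_ideal_def act_ideal_gen[OF assms(2)] image_image
    by (intro arg_cong[of _ _ ideal_gen] image_cong) auto
  with b(1) that show ?thesis by blast
qed

text \<open>An invertible substitution preserves the dimension in degree \<open>e\<close>, so the
  new point attains the same maximum \<open>t_max\<close>.\<close>

lemma act_U_deg:
  fixes A :: "'k::field ^ 'n::finite ^ 'n"
  assumes "is_enumeration s d mon" "invertible A" "a \<in> U_deg s d mon e"
  obtains b where "b \<in> U_deg s d mon e"
    "graded_part (I_ideal s d mon b) e = act A ` graded_part (I_ideal s d mon a) e"
proof -
  obtain b where b: "b \<in> affine_space CARD('n) s d" "I_ideal s d mon b = act A ` I_ideal s d mon a"
    using act_I_ideal[OF assms(1,2)] by blast
  then have "graded_part (I_ideal s d mon b) e = act A ` graded_part (I_ideal s d mon a) e"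
    by (simp add: act_graded_part[OF assms(2)])
  moreover from this have "b \<in> U_deg s d mon e"
    using b(1) assms(3) by (simp add: U_deg_def hilb_def dim_act_image[OF assms(2)])
  ultimately show ?thesis using that by blast
qed

section \<open>The exterior monomials\<close>

context graded_mon_order
begin

lemma sorted_desc_eq: "sorted_wrt (\<lambda>u v. le v u \<and> u \<noteq> v) ms \<longleftrightarrow> sorted_wrt lt (rev ms)"
proof -
  have "(\<lambda>u v. le v u \<and> u \<noteq> v) = (\<lambda>u v. lt v u)" by (auto simp: lt_def fun_eq_iff)
  then show ?thesis by (simp add: sorted_wrt_rev)
qed

lemma std_ext_monomial_exists:
  assumes "X \<subseteq> monomials e" "card X = t"
  shows "\<exists>!ms. ms \<in> std_ext_monomials le t e \<and> set ms = X"
proof -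
  have fin: "finite X" using assms(1) finite_monomials by (rule finite_subset)
  show ?thesis
  proof (rule ex1I[of _ "rev (ord.sorted_list_of_set X)"])
    show "rev (ord.sorted_list_of_set X) \<in> std_ext_monomials le t e \<and> set (rev (ord.sorted_list_of_set X)) = X"
      using fin assms by (simp add: std_ext_monomials_def sorted_desc_eq)
    fix ms assume "ms \<in> std_ext_monomials le t e \<and> set ms = X"
    then have "sorted_wrt lt (rev ms)" "set ms = X"
      by (simp_all add: std_ext_monomials_def sorted_desc_eq)
    then have "rev ms = ord.sorted_list_of_set X"
      using fin by (intro ord.strict_sorted_equal) auto
    then show "ms = rev (ord.sorted_list_of_set X)" by (metis rev_rev_ident)
  qed
qed

lemma finite_std_ext_monomials: "finite (std_ext_monomials le t e)"
  by (rule finite_subset[OF _ finite_lists_length_eq[OF finite_monomials[of e], of t]])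
     (auto simp: std_ext_monomials_def)

text \<open>Equal lengths rule out the proper-prefix case of \<open>lexord\<close>, so that only
  comparison at the first difference remains.\<close>

lemma ext_ge_iff_lexord:
  assumes "length ms = length ms'"
  shows "ext_ge le ms ms' \<longleftrightarrow> ms = ms' \<or> (ms', ms) \<in> lexord {(u, v). lt u v}"
proof -
  have take_eq: "take i ms' = take i ms \<longleftrightarrow> (\<forall>j<i. ms ! j = ms' ! j)" if "i < length ms" for i
    using that assms by (auto simp: list_eq_iff_nth_eq)
  have "(ms', ms) \<in> lexord {(u, v). lt u v} \<longleftrightarrow>
      (\<exists>i<length ms. take i ms' = take i ms \<and> lt (ms' ! i) (ms ! i))"
    unfolding lexord_take_index_conv using assms by simp
  also have "\<dots> \<longleftrightarrow> (\<exists>i<length ms. (\<forall>j<i. ms ! j = ms' ! j) \<and> lt (ms' ! i) (ms ! i))"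
    using take_eq by (intro ex_cong1) blast
  also have "\<dots> \<longleftrightarrow> (\<exists>i<length ms. ms ! i \<noteq> ms' ! i \<and> (\<forall>j<i. ms ! j = ms' ! j) \<and> le (ms' ! i) (ms ! i))"
  proof (rule ex_cong1)
    fix i show "(i < length ms \<and> (\<forall>j<i. ms ! j = ms' ! j) \<and> lt (ms' ! i) (ms ! i)) =
        (i < length ms \<and> ms ! i \<noteq> ms' ! i \<and> (\<forall>j<i. ms ! j = ms' ! j) \<and> le (ms' ! i) (ms ! i))"
      by (cases "ms ! i = ms' ! i") (auto simp: lt_def)
  qed
  finally show ?thesis
    unfolding ext_ge_def by blast
qed

text \<open>Justifies the \<open>THE\<close> in \<open>max_ext_mon\<close>. The lexicographic order
  is linear on all lists and agrees with \<open>ext_ge\<close> on lists of the common length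
  \<open>t\<close>.\<close>

lemma ext_ge_maximum_unique:
  assumes "finite S" "S \<noteq> {}" "\<And>ms. ms \<in> S \<Longrightarrow> length ms = t"
  shows "\<exists>!M. M \<in> S \<and> (\<forall>ms\<in>S. ext_ge le M ms)"
proof -
  define L where "L = lexord {(u, v). lt u v}"
  have r: "trans {(u, v). lt u v}" "asym {(u, v). lt u v}" "total {(u, v). lt u v}"
    by (auto simp: trans_def total_on_def intro: ord.order.strict_trans asymI)
  have L_trans: "(x, z) \<in> L" if "(x, y) \<in> L" "(y, z) \<in> L" for x y z
    using that r(1) unfolding L_def by (rule lexord_trans)
  have L_asym: "(y, x) \<notin> L" if "(x, y) \<in> L" for x y
    using r(2) that unfolding L_def by (rule lexord_asymmetric)
  have L_total: "(x, y) \<in> L \<or> (y, x) \<in> L" if "x \<noteq> y" for x y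
    using total_lexord[OF r(3)] that by (simp add: L_def total_on_def)
  interpret lex: linorder "\<lambda>x y. x = y \<or> (x, y) \<in> L" "\<lambda>x y. (x, y) \<in> L"
    by unfold_locales (use L_asym L_total in \<open>blast intro: L_trans\<close>)+
  have ext_ge: "ext_ge le x y \<longleftrightarrow> y = x \<or> (y, x) \<in> L" if "x \<in> S" "y \<in> S" for x y
    unfolding L_def using that assms(3) by (subst ext_ge_iff_lexord) auto
  have Max: "lex.Max S \<in> S" "ms = lex.Max S \<or> (ms, lex.Max S) \<in> L" if "ms \<in> S" for ms
    using lex.Max_in[OF assms(1,2)] lex.Max_ge[OF assms(1) that] by auto
  show ?thesis
  proof (rule ex1I[of _ "lex.Max S"])
    show "lex.Max S \<in> S \<and> (\<forall>ms\<in>S. ext_ge le (lex.Max S) ms)"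
      using Max ext_ge assms(2) by auto
    fix M assume M: "M \<in> S \<and> (\<forall>ms\<in>S. ext_ge le M ms)"
    then have "lex.Max S = M \<or> (lex.Max S, M) \<in> L"
      using ext_ge Max(1) by blast
    then show "M = lex.Max S"
      using Max(2)[of M] M L_asym by blast
  qed
qed

text \<open>Turns a count into a bound at a position: in a decreasing list the entries at least
  \<open>l\<close> come first, so more than \<open>j\<close> of them cover position
  \<open>j\<close>, counted from zero.\<close>

lemma sorted_desc_nth_ge:
  assumes "ms \<in> std_ext_monomials le t e" "j < card {x \<in> set ms. le l x}"
  shows "j < length ms" "le l (ms ! j)"
proof -
  have "card {x \<in> set ms. le l x} \<le> card (set ms)" by (intro card_mono) auto
  with assms(2) card_length[of ms] show "j < length ms" by linarith
  show "le l (ms ! j)"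
  proof (rule ccontr)
    assume not_ge: "\<not> le l (ms ! j)"
    have "{x \<in> set ms. le l x} \<subseteq> (!) ms ` {..<j}"
    proof
      fix x assume "x \<in> {x \<in> set ms. le l x}"
      then obtain i where i: "i < length ms" "x = ms ! i" "le l (ms ! i)"
        by (auto simp: in_set_conv_nth)
      have "le (ms ! i) (ms ! j)" if "j \<le> i"
        using that assms(1) i(1) sorted_wrt_nth_less[of _ ms j i]
        by (cases "i = j") (auto simp: std_ext_monomials_def)
      then have "i < j" using i(3) not_ge ord.order.trans not_less by blast
      then show "x \<in> (!) ms ` {..<j}" using i by auto
    qed
    then have "card {x \<in> set ms. le l x} \<le> j"
      using surj_card_le[of "{..<j}" _ "(!) ms"] by simp
    with assms(2) show False by simp
  qed
qed

end

section \<open>Upper triangular substitutions\<close>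

text \<open>A permutation with \<open>i \<le> p i\<close> everywhere is the identity, as it would
  otherwise raise the sum of ranks, which permutations preserve. Every other Leibniz term therefore
  contains an entry below the diagonal.\<close>

lemma upper_triangular_det:
  fixes A :: "'k::field ^ 'n::{finite, linorder} ^ 'n::{finite, linorder}"
  assumes "\<And>i j. j < i \<Longrightarrow> A $ i $ j = 0"
  shows "Determinants.det A = (\<Prod>i\<in>UNIV. A $ i $ i)"
proof -
  define idx where "idx = (\<lambda>i::'n. card {..<i})"
  have idx: "idx i < idx j" if "i < j" for i j
    unfolding idx_def using that by (intro psubset_card_mono) auto
  have id: "p = id" if p: "p permutes UNIV" "\<And>i. i \<le> p i" for p :: "'n \<Rightarrow> 'n"
  proof (rule ccontr)
    assume "p \<noteq> id"
    then obtain i where "p i \<noteq> i" by (auto simp: fun_eq_iff)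
    with p(2)[of i] have "idx i < idx (p i)" using idx by simp
    moreover have "idx k \<le> idx (p k)" for k using p(2)[of k] idx[of k "p k"] by (metis le_less)
    ultimately have "(\<Sum>i\<in>UNIV. idx i) < (\<Sum>i\<in>UNIV. idx (p i))"
      by (intro sum_strict_mono_ex1) auto
    moreover have "(\<Sum>i\<in>UNIV. idx (p i)) = (\<Sum>i\<in>UNIV. idx i)"
      using p(1) by (intro sum.reindex_bij_betw permutes_imp_bij)
    ultimately show False by simp
  qed
  have vanish: "(\<Prod>i\<in>UNIV. A $ i $ p i) = 0" if p: "p permutes UNIV" "p \<noteq> id" for p
  proof -
    obtain i where "p i < i" using id[OF p(1)] p(2) not_less by blast
    with assms show ?thesis by (intro prod_zero) auto
  qed
  have "Determinants.det A = (\<Sum>p\<in>{p. p permutes (UNIV :: 'n set)}. if p = id then \<Prod>i\<in>UNIV. A $ i $ i else 0)"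
    unfolding Determinants.det_def by (intro sum.cong) (auto simp: sign_id vanish)
  also have "\<dots> = (\<Prod>i\<in>UNIV. A $ i $ i)"
    by (subst sum.delta) (auto simp: permutes_id)
  finally show ?thesis .
qed

lemma borel_group_diag_nonzero:
  assumes "A \<in> borel_group"
  shows "A $ i $ i \<noteq> 0"
proof -
  have "Determinants.det A \<noteq> 0"
    using assms invertible_det_nz by (auto simp: borel_group_def)
  moreover have "Determinants.det A = (\<Prod>i\<in>UNIV. A $ i $ i)"
    using assms by (intro upper_triangular_det) (auto simp: borel_group_def)
  ultimately show ?thesis by (metis finite prod_zero_iff UNIV_I)
qed

locale borel_mon_order = graded_mon_order le
  for le :: "('n::{finite, linorder}) monomial \<Rightarrow> 'n monomial \<Rightarrow> bool" +
  assumes variable_order: "i \<le> j \<Longrightarrow> le (varmon j) (varmon i)"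
begin

text \<open>The lowest term for the order, with a coefficient that may be zero; its nonvanishing is
  supplied later by the diagonal of \<open>A\<close>. The point is that lowest terms
  multiply.\<close>

definition trailing :: "'n monomial \<Rightarrow> 'k::field \<Rightarrow> ('n, 'k) mpoly \<Rightarrow> bool" where
  "trailing m c f \<longleftrightarrow> (\<exists>g. f = pscale c (xmon m) + g \<and> (\<forall>u\<in>Poly_Mapping.keys g. lt m u))"

lemma trailing_mult:
  assumes "trailing m c f" "trailing m' c' f'"
  shows "trailing (m + m') (c * c') (f * f')"
proof -
  obtain g where g: "f = pscale c (xmon m) + g" "\<And>u. u \<in> Poly_Mapping.keys g \<Longrightarrow> lt m u"
    using assms(1) by (auto simp: trailing_def)
  obtain g' where g': "f' = pscale c' (xmon m') + g'" "\<And>u. u \<in> Poly_Mapping.keys g' \<Longrightarrow> lt m' u"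
    using assms(2) by (auto simp: trailing_def)
  \<comment> \<open>Every product in \<open>?h\<close> has at least one factor strictly above the
    lowest term, and \<open>lt_add\<close> asks for strictness in one factor.\<close>
  let ?h = "pscale c (xmon m * g') + pscale c' (xmon m' * g) + g * g'"
  have "f * f' = pscale (c * c') (xmon (m + m')) + ?h"
    by (simp add: g(1) g'(1) algebra_simps pscale_mult_left pscale_mult_right xmon_add)
  moreover have "lt (m + m') u" if u: "u \<in> Poly_Mapping.keys ?h" for u
  proof -
    consider "u \<in> Poly_Mapping.keys (xmon m * g')" | "u \<in> Poly_Mapping.keys (xmon m' * g)"
      | "u \<in> Poly_Mapping.keys (g * g')"
      using u keys_add[of "pscale c (xmon m * g') + pscale c' (xmon m' * g)" "g * g'"]
        keys_add[of "pscale c (xmon m * g')" "pscale c' (xmon m' * g)"]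
        keys_pscale[of c "xmon m * g'"] keys_pscale[of c' "xmon m' * g"] by blast
    then show ?thesis
    proof cases
      case 1
      then show ?thesis
        using g'(2) lt_add[of m' _ m m] by (auto simp: keys_xmon_mult add.commute)
    next
      case 2
      then show ?thesis
        using g(2) lt_add[of m _ m' m'] by (auto simp: keys_xmon_mult add.commute)
    next
      case 3
      then obtain v v' where v: "v \<in> Poly_Mapping.keys g" "v' \<in> Poly_Mapping.keys g'" "u = v + v'"
        using keys_mult[of g g'] by blast
      show ?thesis
        unfolding v(3) using g(2)[OF v(1)] g'(2)[OF v(2)]
        by (rule lt_add[OF _ ord.less_imp_le])
    qed
  qed
  ultimately show ?thesis unfolding trailing_def by blast
qed

lemma trailing_one: "trailing 0 1 1"
  unfolding trailing_def by (intro exI[of _ 0]) (simp add: xmon_def)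

lemma trailing_power:
  assumes "trailing m c f"
  shows "trailing (\<Sum>i<k. m) (c ^ k) (f ^ k)"
proof (induction k)
  case (Suc k)
  then have "trailing ((\<Sum>i<k. m) + m) (c ^ k * c) (f ^ k * f)"
    using assms by (rule trailing_mult)
  then show ?case by (simp add: mult.commute)
qed (simp add: trailing_one)

lemma trailing_prod:
  "(\<And>i. i \<in> I \<Longrightarrow> trailing (m i) (c i) (f i)) \<Longrightarrow>
    trailing (\<Sum>i\<in>I. m i) (\<Prod>i\<in>I. c i) (\<Prod>i\<in>I. f i)"
  by (induction I rule: infinite_finite_induct) (simp_all add: trailing_one trailing_mult)

text \<open>An upper triangular \<open>A\<close> sends \<open>x_j\<close> to a combination of
  \<open>x_i\<close> with \<open>i \<le> j\<close>, and these are the variables at least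
  \<open>x_j\<close>. Taking products carries this from variables to monomials.\<close>

lemma trailing_act_mon:
  assumes "A \<in> borel_group"
  shows "trailing m (\<Prod>j\<in>UNIV. A $ j $ j ^ Poly_Mapping.lookup m j) (act_mon A m)"
proof -
  have var: "trailing (varmon j) (A $ j $ j) (act_var A j)" for j
  proof -
    let ?g = "\<Sum>i\<in>UNIV - {j}. pscale (A $ i $ j) (xmon (varmon i))"
    have "act_var A j = pscale (A $ j $ j) (xmon (varmon j)) + ?g"
      unfolding act_var_def by (subst sum.remove[of _ j]) auto
    moreover have "lt (varmon j) u" if u: "u \<in> Poly_Mapping.keys ?g" for u
    proof -
      have "Poly_Mapping.lookup ?g u \<noteq> 0" using u by (simp add: in_keys_iff)
      then obtain i where i: "i \<in> UNIV - {j}"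
        "Poly_Mapping.lookup (pscale (A $ i $ j) (xmon (varmon i))) u \<noteq> 0"
        unfolding lookup_sum by (rule sum.not_neutral_contains_not_neutral)
      then have i: "i \<noteq> j" "A $ i $ j \<noteq> 0"
        "Poly_Mapping.lookup (xmon (varmon i) :: ('n, 'a) mpoly) u \<noteq> 0" by auto
      then have "u = varmon i" by (simp add: lookup_xmon split: if_splits)
      moreover have "i \<le> j" using i(2) assms not_le by (auto simp: borel_group_def)
      moreover have "varmon i \<noteq> varmon j"
        using i(1) by (metis lookup_single_eq lookup_single_not_eq one_neq_zero varmon_def)
      ultimately show ?thesis using variable_order by (auto simp: lt_def)
    qed
    ultimately show ?thesis unfolding trailing_def by blast
  qed
  have "(\<Sum>i<k. varmon j) = Poly_Mapping.single j k" for j :: 'n and k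
    by (induction k) (simp_all add: varmon_def single_add[symmetric])
  then have "trailing (Poly_Mapping.single j k) (A $ j $ j ^ k) (act_var A j ^ k)" for j k
    using trailing_power[OF var, of j k] by simp
  then have "trailing (\<Sum>j\<in>UNIV. Poly_Mapping.single j (Poly_Mapping.lookup m j))
      (\<Prod>j\<in>UNIV. A $ j $ j ^ Poly_Mapping.lookup m j) (act_mon A m)"
    unfolding act_mon_def by (intro trailing_prod)
  then show ?thesis by (simp add: monomial_eq_sum)
qed

lemma act_mon_borel:
  assumes A: "A \<in> borel_group"
  shows "Poly_Mapping.lookup (act_mon A m) m \<noteq> 0"
    and "u \<in> Poly_Mapping.keys (act_mon A m) \<Longrightarrow> le m u"
proof -
  let ?c = "\<Prod>j\<in>UNIV. A $ j $ j ^ Poly_Mapping.lookup m j"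
  obtain g where g: "act_mon A m = pscale ?c (xmon m) + g" "\<And>u. u \<in> Poly_Mapping.keys g \<Longrightarrow> lt m u"
    using trailing_act_mon[OF A, of m] by (auto simp: trailing_def)
  have "Poly_Mapping.lookup g m = 0"
    using g(2)[of m] by (auto simp: in_keys_iff lt_def)
  then show "Poly_Mapping.lookup (act_mon A m) m \<noteq> 0"
    using borel_group_diag_nonzero[OF A] by (simp add: g(1) lookup_add lookup_xmon)
  show "le m u" if "u \<in> Poly_Mapping.keys (act_mon A m)"
  proof (cases "u = m")
    case False
    then have "u \<in> Poly_Mapping.keys g"
      using that by (simp add: g(1) in_keys_iff lookup_add lookup_xmon)
    then show ?thesis using g(2) by (auto simp: lt_def)
  qed simp
qed

end

section \<open>Generic diagonal substitutions\<close>

text \<open>The weights are powers \<open>b ^ idx i\<close>. Two distinct monomials have equal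
  weight only if \<open>b\<close> is a root of a nonzero polynomial whose coefficients are the
  differences of exponents; some natural number avoids the finitely many roots. Real coefficients
  keep this independent of the characteristic of \<open>'k\<close>.\<close>

lemma exists_separating_weight:
  fixes X :: "'n::finite monomial set"
  assumes "finite X"
  obtains w :: "'n \<Rightarrow> nat" where "inj_on (\<lambda>m. \<Sum>i\<in>UNIV. w i * Poly_Mapping.lookup m i) X"
proof -
  obtain idx :: "'n \<Rightarrow> nat" where idx: "inj idx"
    using finite_imp_inj_to_nat_seg[OF finite[of "UNIV :: 'n set"]] by blast
  define P where "P = (\<lambda>(m, m'). \<Sum>i\<in>UNIV.
    monom (real (Poly_Mapping.lookup m i) - real (Poly_Mapping.lookup m' i)) (idx i))"
  define Q where "Q = {p \<in> X \<times> X. fst p \<noteq> snd p}"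
  have "P p \<noteq> 0" if pQ: "p \<in> Q" for p
  proof -
    obtain m m' where p: "p = (m, m')" "m \<noteq> m'" using pQ by (cases p) (auto simp: Q_def)
    obtain i where i: "Poly_Mapping.lookup m i \<noteq> Poly_Mapping.lookup m' i"
      using p(2) by (metis poly_mapping_eqI)
    have "coeff (P p) (idx i) = (\<Sum>j\<in>UNIV. if j = i then
        real (Poly_Mapping.lookup m i) - real (Poly_Mapping.lookup m' i) else 0)"
      unfolding P_def p(1) using idx by (auto simp: coeff_sum inj_eq intro!: sum.cong)
    with i have "coeff (P p) (idx i) \<noteq> 0" by simp
    then show ?thesis by auto
  qed
  moreover have "finite Q" using assms by (simp add: Q_def)
  ultimately have "finite (\<Union>p\<in>Q. {x. poly (P p) x = 0})"
    using poly_roots_finite by auto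
  then have "finite (real -` (\<Union>p\<in>Q. {x. poly (P p) x = 0}))"
    by (rule finite_vimageI) (simp add: inj_on_def)
  then obtain b :: nat where b: "b \<notin> real -` (\<Union>p\<in>Q. {x. poly (P p) x = 0})"
    using ex_new_if_finite[OF infinite_UNIV_nat] by blast
  have "inj_on (\<lambda>m. \<Sum>i\<in>UNIV. b ^ idx i * Poly_Mapping.lookup m i) X"
  proof (rule inj_onI, rule ccontr)
    fix m m' assume m: "m \<in> X" "m' \<in> X" "m \<noteq> m'"
      and eq: "(\<Sum>i\<in>UNIV. b ^ idx i * Poly_Mapping.lookup m i) = (\<Sum>i\<in>UNIV. b ^ idx i * Poly_Mapping.lookup m' i)"
    have "poly (P (m, m')) (real b) = real (\<Sum>i\<in>UNIV. b ^ idx i * Poly_Mapping.lookup m i)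
        - real (\<Sum>i\<in>UNIV. b ^ idx i * Poly_Mapping.lookup m' i)"
      by (simp add: P_def poly_sum poly_monom algebra_simps sum_subtractf)
    then have "poly (P (m, m')) (real b) = 0" by (simp add: eq)
    with b m show False by (auto simp: Q_def)
  qed
  then show ?thesis by (rule that)
qed

definition diagonal :: "('n \<Rightarrow> 'k::zero) \<Rightarrow> 'k ^ 'n ^ 'n" where
  "diagonal x = (\<chi> i j. if i = j then x j else 0)"

lemma diagonal_nth: "diagonal x $ i $ j = (if i = j then x j else 0)"
  by (simp add: diagonal_def)

lemma invertible_diagonal:
  fixes x :: "'n::finite \<Rightarrow> 'k::field"
  assumes "\<And>i. x i \<noteq> 0"
  shows "invertible (diagonal x)"
  using assms by (simp add: invertible_det_nz Determinants.det_diagonal diagonal_nth)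

context borel_mon_order
begin

text \<open>For \<open>g = A ** D\<close> the matrix \<open>D\<close> scales each monomial by
  \<open>z\<close> to its weight before \<open>A\<close> acts, so the coefficients of
  \<open>act g (f k)\<close> have exactly the shape treated in
  \<open>triangular_minors_generic\<close>.\<close>

lemma act_diagonal_generic_minors:
  fixes f :: "nat \<Rightarrow> ('n, 'k::field) mpoly" and A :: "'k ^ 'n::{finite, linorder} ^ 'n::{finite, linorder}"
  assumes inf: "infinite (UNIV :: 'k set)"
    and A: "A \<in> borel_group"
    and f: "\<And>k. k < q \<Longrightarrow> f k \<in> homogeneous e" "\<And>k. k < q \<Longrightarrow> f k \<noteq> 0"
    and triangular: "\<And>k i. k < i \<Longrightarrow> i < q \<Longrightarrow> Poly_Mapping.lookup (act_mon A (init_mon le (f k))) (l i) = 0"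
      "\<And>k. k < q \<Longrightarrow> Poly_Mapping.lookup (act_mon A (init_mon le (f k))) (l k) \<noteq> 0"
  obtains g where "invertible g" "\<And>r. r \<le> q \<Longrightarrow>
    Determinant.det (Matrix.mat r r (\<lambda>(k, i). Poly_Mapping.lookup (act g (f k)) (l i))) \<noteq> 0"
proof -
  define T where "T = (monomials e :: 'n monomial set)"
  have "finite T" by (simp add: T_def finite_monomials)
  \<comment> \<open>The exponents of \<open>z\<close> in a minor of size \<open>r\<close> are
    weights of sums of \<open>r\<close> monomials of degree \<open>e\<close>; \<open>X\<close>
    collects these sums for all sizes at once.\<close>
  define X where "X = (\<Union>r\<le>q. (\<lambda>\<phi>. \<Sum>k<r. \<phi> k) ` ({..<r} \<rightarrow>\<^sub>E T))"
  have "finite X"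
    unfolding X_def using \<open>finite T\<close> by (auto intro!: finite_imageI finite_PiE)
  then obtain w where w: "inj_on (\<lambda>m. \<Sum>i\<in>UNIV. w i * Poly_Mapping.lookup m i) X"
    by (rule exists_separating_weight)
  define wt where "wt = (\<lambda>m :: 'n monomial. \<Sum>i\<in>UNIV. w i * Poly_Mapping.lookup m i)"
  have wt_sum: "wt (\<Sum>k\<in>I. \<phi> k) = (\<Sum>k\<in>I. wt (\<phi> k))" for \<phi> :: "nat \<Rightarrow> 'n monomial" and I
    unfolding wt_def lookup_sum by (simp add: sum_distrib_left sum.swap[of _ I])
  have X: "(\<Sum>k<r. \<phi> k) \<in> X" if "r \<le> q" "\<And>k. k < r \<Longrightarrow> \<phi> k \<in> T" for r \<phi>
    unfolding X_def using that
    by (intro UN_I[of r] image_eqI[of _ _ "restrict \<phi> {..<r}"]) auto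
  define m where "m = (\<lambda>k. init_mon le (f k))"
  have m: "m k \<in> T" "Poly_Mapping.lookup (f k) (m k) \<noteq> 0"
    "\<And>n. Poly_Mapping.lookup (f k) n \<noteq> 0 \<Longrightarrow> le n (m k)" if "k < q" for k
    using init_mon_props[OF f(2)[OF that]] f(1)[OF that]
    by (auto simp: m_def T_def homogeneous_def in_keys_iff)
  \<comment> \<open>Equal weights give equal sums by separation on \<open>X\<close>; since each
    \<open>\<phi> k\<close> is at most the initial monomial \<open>m k\<close>, equal sums force
    equality in every factor.\<close>
  have unique: "\<forall>k<r. \<phi> k = m k"
    if "r \<le> q" and \<phi>: "\<forall>k<r. \<phi> k \<in> T \<and> Poly_Mapping.lookup (f k) (\<phi> k) \<noteq> 0"
      and eq: "(\<Sum>k<r. wt (\<phi> k)) = (\<Sum>k<r. wt (m k))" for r \<phi>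
  proof (intro allI impI)
    fix k assume "k < r"
    have "(\<Sum>k<r. \<phi> k) = (\<Sum>k<r. m k)"
    proof (rule inj_onD[OF w])
      show "(\<Sum>k<r. \<phi> k) \<in> X" "(\<Sum>k<r. m k) \<in> X"
        using \<phi> m \<open>r \<le> q\<close> by (auto intro!: X)
      show "(\<Sum>i\<in>UNIV. w i * Poly_Mapping.lookup (\<Sum>k<r. \<phi> k) i)
          = (\<Sum>i\<in>UNIV. w i * Poly_Mapping.lookup (\<Sum>k<r. m k) i)"
        using eq unfolding wt_sum[symmetric] by (simp add: wt_def)
    qed
    then show "\<phi> k = m k"
      using \<phi> m(3) \<open>r \<le> q\<close> \<open>k < r\<close> by (intro sum_eq_imp_eq[where f = \<phi> and g = m and I = "{..<r}"]) auto
  qed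
  have tri: "Poly_Mapping.lookup (act_mon A (m k)) (l i) = 0" if "k < i" "i < q" for k i
    using triangular(1)[OF that] by (simp add: m_def)
  have diag: "Poly_Mapping.lookup (act_mon A (m k)) (l k) \<noteq> 0" if "k < q" for k
    using triangular(2)[OF that] by (simp add: m_def)
  obtain z where z: "z \<noteq> 0" "\<And>r. r \<le> q \<Longrightarrow> Determinant.det (Matrix.mat r r (\<lambda>(k, i).
      \<Sum>n\<in>T. Poly_Mapping.lookup (f k) n * z ^ wt n * Poly_Mapping.lookup (act_mon A n) (l i))) \<noteq> 0"
    by (rule triangular_minors_generic[where m = m and w = wt and q = q and T = T
        and c = "\<lambda>k. Poly_Mapping.lookup (f k)"
        and B = "\<lambda>i n. Poly_Mapping.lookup (act_mon A n) (l i)",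
        OF inf \<open>finite T\<close> m(1,2) unique tri diag])
       (assumption | (rule that, assumption, blast))+
  define D :: "'k ^ 'n::{finite, linorder} ^ 'n::{finite, linorder}" where "D = diagonal (\<lambda>i. z ^ w i)"
  have "invertible (A ** D)"
    using A z(1) by (auto simp: borel_group_def D_def intro!: invertible_mult invertible_diagonal)
  moreover have "Poly_Mapping.lookup (act (A ** D) (f k)) (l i)
      = (\<Sum>n\<in>T. Poly_Mapping.lookup (f k) n * z ^ wt n * Poly_Mapping.lookup (act_mon A n) (l i))"
    if "k < q" for k i
  proof -
    have "act_mon D n = pscale (z ^ wt n) (xmon n)" for n
      by (subst act_diag[of D "\<lambda>i. z ^ w i"])
         (simp_all add: D_def diagonal_nth wt_def power_sum power_mult)
    then have "act D (f k) = (\<Sum>n\<in>T. pscale (Poly_Mapping.lookup (f k) n * z ^ wt n) (xmon n))"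
      using f(1)[OF that] \<open>finite T\<close> by (subst act_eq_sum[of T]) (auto simp: T_def homogeneous_def)
    then show ?thesis
      unfolding act_act[symmetric] by (simp add: act_sum act_pscale act_xmon lookup_sum)
  qed
  then have "Matrix.mat r r (\<lambda>(k, i). Poly_Mapping.lookup (act (A ** D) (f k)) (l i))
      = Matrix.mat r r (\<lambda>(k, i). \<Sum>n\<in>T. Poly_Mapping.lookup (f k) n * z ^ wt n *
          Poly_Mapping.lookup (act_mon A n) (l i))" if "r \<le> q" for r
    using that by (intro eq_matI) auto
  ultimately show ?thesis
    using that[of "A ** D"] z(2) by simp
qed

end

section \<open>Borel-fixedness\<close>

context borel_mon_order
begin

text \<open>With \<open>u\<close> maximal among the monomials that \<open>A\<close> moves out of the initial space and \<open>v\<close> a new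
  monomial of \<open>A u\<close>, the coefficients of \<open>A m\<^sub>0, \<dots>, A m\<^sub>p\<^sub>-\<^sub>1, A u\<close> at \<open>m\<^sub>0, \<dots>, m\<^sub>p\<^sub>-\<^sub>1, v\<close>, where
  \<open>m\<^sub>0, \<dots>, m\<^sub>p\<^sub>-\<^sub>1\<close> are the initial monomials above \<open>v\<close>, form a triangular matrix.\<close>

lemma exists_larger_exterior_monomial:
  fixes W :: "('n, 'k::field) mpoly set" and A :: "'k ^ 'n::{finite, linorder} ^ 'n::{finite, linorder}"
  assumes inf: "infinite (UNIV :: 'k set)"
    and A: "A \<in> borel_group"
    and sub: "mp.subspace W" and hom: "W \<subseteq> homogeneous e"
    and ms: "ms \<in> std_ext_monomials le t e" "set ms = initials le W"
    and moved: "u\<^sub>0 \<in> initials le W" "\<not> Poly_Mapping.keys (act_mon A u\<^sub>0) \<subseteq> initials le W"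
  obtains g where "invertible g"
    "\<And>ms'. ms' \<in> std_ext_monomials le t e \<Longrightarrow> set ms' = initials le (act g ` W) \<Longrightarrow> \<not> ext_ge le ms ms'"
proof -
  define Bad where "Bad = {u \<in> initials le W. \<not> Poly_Mapping.keys (act_mon A u) \<subseteq> initials le W}"
  have "finite Bad" "Bad \<noteq> {}"
    using finite_initials[OF hom] moved by (auto simp: Bad_def)
  define u where "u = ord.Max Bad"
  have u: "u \<in> Bad" and u_max: "\<And>u'. u' \<in> Bad \<Longrightarrow> le u' u"
    using \<open>finite Bad\<close> \<open>Bad \<noteq> {}\<close> by (auto simp: u_def)
  then obtain v where v: "v \<in> Poly_Mapping.keys (act_mon A u)" "v \<notin> initials le W"
    by (auto simp: Bad_def)
  have "u \<in> set ms" using u ms(2) by (auto simp: Bad_def)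
  have "lt u v"
    using act_mon_borel(2)[OF A v(1)] v(2) u by (auto simp: lt_def Bad_def)
  have desc: "lt (ms ! j) (ms ! i)" if "i < j" "j < length ms" for i j
  proof -
    have "sorted_wrt (\<lambda>u v. le v u \<and> u \<noteq> v) ms"
      using ms(1) by (simp add: std_ext_monomials_def)
    from sorted_wrt_nth_less[OF this that] show ?thesis by (auto simp: lt_def)
  qed
  have len: "length ms = t" using ms(1) by (simp add: std_ext_monomials_def)
  \<comment> \<open>The position where the comparison will be decided: \<open>v\<close> would be
    inserted here. It exists because \<open>u\<close> is itself an entry below
    \<open>v\<close>.\<close>
  define p where "p = (LEAST i. i < t \<and> lt (ms ! i) v)"
  have "\<exists>i. i < t \<and> lt (ms ! i) v"
    using \<open>u \<in> set ms\<close> \<open>lt u v\<close> len by (auto simp: in_set_conv_nth)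
  then have "p < t \<and> lt (ms ! p) v"
    unfolding p_def by (rule LeastI_ex)
  then have p: "p < t" "lt (ms ! p) v" by auto
  have above: "ms ! i \<in> initials le W" "lt v (ms ! i)" if "i < p" for i
  proof -
    show in_W: "ms ! i \<in> initials le W"
      using that p(1) len ms(2) by (metis nth_mem order.strict_trans)
    have "\<not> lt (ms ! i) v"
      using that p(1) not_less_Least[of i "\<lambda>i. i < t \<and> lt (ms ! i) v"] by (auto simp: p_def)
    moreover have "v \<noteq> ms ! i" using in_W v(2) by auto
    ultimately show "lt v (ms ! i)" using ord.less_linear by blast
  qed
  \<comment> \<open>Maximality of \<open>u\<close> enters here: a moved entry would be at most
    \<open>u\<close>, whereas the entries before \<open>p\<close> exceed \<open>v\<close> and hence
    \<open>u\<close>.\<close>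
  have stable: "Poly_Mapping.keys (act_mon A (ms ! i)) \<subseteq> initials le W" if "i < p" for i
  proof (rule ccontr)
    assume "\<not> ?thesis"
    then have "le (ms ! i) u"
      using above[OF that] u_max by (auto simp: Bad_def)
    moreover have "lt u (ms ! i)"
      using \<open>lt u v\<close> above(2)[OF that] by (rule ord.order.strict_trans)
    ultimately show False by (simp add: ord.leD)
  qed
  \<comment> \<open>The last row belongs to \<open>u\<close>, which may differ from
    \<open>ms ! p\<close>; the last column belongs to \<open>v\<close>.\<close>
  define m where "m = (\<lambda>k. if k < p then ms ! k else u)"
  define l where "l = (\<lambda>k. if k < p then ms ! k else v)"
  have "\<exists>f. f \<in> W \<and> f \<noteq> 0 \<and> init_mon le f = m k" for k
    using above(1)[of k] u by (auto simp: m_def Bad_def elim!: initialsE)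
  then obtain f where f: "f k \<in> W" "f k \<noteq> 0" "init_mon le (f k) = m k" for k
    by metis
  \<comment> \<open>Two different reasons: in a column before \<open>p\<close>, the monomial lies
    below everything that \<open>A\<close> makes of \<open>ms ! k\<close>; in the last column,
    \<open>v\<close> is not an initial monomial while \<open>A\<close> keeps \<open>ms ! k\<close>
    among them.\<close>
  have upper: "Poly_Mapping.lookup (act_mon A (m k)) (l i) = 0" if "k < i" "i < Suc p" for k i
  proof (cases "i < p")
    case True
    then have "lt (ms ! i) (ms ! k)" using that p(1) len by (intro desc) auto
    then have "ms ! i \<notin> Poly_Mapping.keys (act_mon A (ms ! k))"
      using act_mon_borel(2)[OF A] ord.leD by blast
    then show ?thesis using True that by (simp add: m_def l_def in_keys_iff)
  next
    case False
    then have "v \<notin> Poly_Mapping.keys (act_mon A (ms ! k))"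
      using that stable[of k] v(2) by auto
    then show ?thesis using False that by (simp add: m_def l_def in_keys_iff)
  qed
  have diag: "Poly_Mapping.lookup (act_mon A (m k)) (l k) \<noteq> 0" if "k < Suc p" for k
    using act_mon_borel(1)[OF A] v(1) by (auto simp: m_def l_def in_keys_iff)
  have l_desc: "le (l j) (l i)" if "i \<le> j" "j < Suc p" for i j
    using that desc[of i j] above(2)[of i] p(1) len
    by (cases "i = j") (auto simp: l_def lt_def)
  have f_hom: "f k \<in> homogeneous e" for k
    using f(1) hom by blast
  obtain g where g: "invertible g" "\<And>r. r \<le> Suc p \<Longrightarrow>
      Determinant.det (Matrix.mat r r (\<lambda>(k, i). Poly_Mapping.lookup (act g (f k)) (l i))) \<noteq> 0"
    by (rule act_diagonal_generic_minors[where f = f and l = l and q = "Suc p", OF inf A f_hom f(2)])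
       (auto simp: f(3) upper diag)
  show ?thesis
  proof (rule that[OF g(1)])
    fix ms' assume ms': "ms' \<in> std_ext_monomials le t e" "set ms' = initials le (act g ` W)"
    have len': "length ms' = t" using ms'(1) by (simp add: std_ext_monomials_def)
    \<comment> \<open>The leading minor of size \<open>Suc j\<close> has its columns in
      \<open>l 0, ..., l j\<close>, all at least \<open>l j\<close>, and so yields enough initial
      monomials to reach position \<open>j\<close>.\<close>
    have ge: "le (l j) (ms' ! j)" if "j < Suc p" for j
    proof (rule sorted_desc_nth_ge(2)[OF ms'(1)])
      have "Suc j \<le> card {x \<in> initials le (act g ` W). le (l j) x}"
      proof (rule minor_nonzero_imp_initials_ge)
        show "mp.subspace (act g ` W)" by (rule subspace_act_image[OF sub])
        show "act g ` W \<subseteq> homogeneous e" using hom act_homogeneous by blast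
        show "Determinant.det (Matrix.mat (Suc j) (Suc j) (\<lambda>(k, i). Poly_Mapping.lookup (act g (f k)) (l i))) \<noteq> 0"
          using that by (intro g(2)) auto
      qed (use f(1) l_desc that in auto)
      then show "j < card {x \<in> set ms'. le (l j) x}" by (simp add: ms'(2))
    qed
    have ge_v: "lt (ms ! p) (ms' ! p)"
      using ge[of p] p(2) by (auto simp: l_def intro: ord.order.strict_trans2)
    show "\<not> ext_ge le ms ms'"
    proof
      assume "ext_ge le ms ms'"
      then consider "ms = ms'"
        | i where "ms ! i \<noteq> ms' ! i" "\<forall>j<i. ms ! j = ms' ! j" "le (ms' ! i) (ms ! i)"
        unfolding ext_ge_def by blast
      then show False
      proof cases
        case 1
        then show False using ge_v by simp
      next
        case 2
        \<comment> \<open>A first difference before \<open>p\<close> contradicts \<open>ge\<close>,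
          one at \<open>p\<close> contradicts \<open>ge_v\<close>, and one after \<open>p\<close>
          would require agreement at \<open>p\<close>.\<close>
        consider "i < p" | "i = p" | "p < i" by linarith
        then show False
        proof cases
          case 1
          then have "le (ms ! i) (ms' ! i)" using ge[of i] by (simp add: l_def)
          then show False using 2 ord.order.antisym by blast
        qed (use 2 ge_v in \<open>auto dest: ord.leD\<close>)
      qed
    qed
  qed
qed

text \<open>Stability gives one inclusion. For the other, \<open>A\<close> maps an initial monomial
  to a nonzero multiple of itself plus larger initial monomials, so the monomials of one degree are
  recovered in the image from the largest downwards.\<close>

lemma initials_borel_stable_imp_borel_fixed:
  fixes J :: "('n, 'k::field) mpoly set"
  assumes J: "homogeneous_ideal J"
    and stable: "\<And>A u. A \<in> borel_group \<Longrightarrow> u \<in> initials le J \<Longrightarrow>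
      Poly_Mapping.keys (act_mon (A :: 'k ^ 'n::{finite, linorder} ^ 'n::{finite, linorder}) u) \<subseteq> initials le J"
  shows "borel_fixed (init_ideal le J)"
  unfolding borel_fixed_def
proof (intro conjI ballI)
  have ideal: "is_ideal J" using J by (simp add: homogeneous_ideal_def)
  then show "is_ideal (init_ideal le J)" by (rule is_ideal_init_ideal)
  have init: "init_ideal le J = {f. Poly_Mapping.keys f \<subseteq> initials le J}"
    using is_ideal_subspace[OF ideal] by (rule init_ideal_eq)
  fix A :: "'k ^ 'n::{finite, linorder} ^ 'n::{finite, linorder}"
  assume A: "A \<in> borel_group"
  have sub: "mp.subspace (init_ideal le J)" unfolding init by (rule subspace_keys_subset)
  have span: "f \<in> S" if "mp.subspace S" "Poly_Mapping.keys f \<subseteq> M" "\<And>m. m \<in> M \<Longrightarrow> xmon m \<in> S"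
    for f and S :: "('n, 'k) mpoly set" and M
    using that by (subst mpoly_eq_sum[of "Poly_Mapping.keys f" f])
      (auto intro!: mp.subspace_sum mp.subspace_scale)
  show "act A ` init_ideal le J = init_ideal le J"
  proof
    have "act A f \<in> init_ideal le J" if "f \<in> init_ideal le J" for f
      unfolding act_eq_sum[OF finite_keys order.refl]
      using that stable[OF A] sub by (intro mp.subspace_sum mp.subspace_scale) (auto simp: init)
    then show "act A ` init_ideal le J \<subseteq> init_ideal le J" by blast
    note sub' = subspace_act_image[OF sub, of A]
    have "xmon u \<in> act A ` init_ideal le J" if "u \<in> initials le J" for u
    proof (rule ccontr)
      assume not_in: "xmon u \<notin> act A ` init_ideal le J"
      \<comment> \<open>Fixing the degree makes this set finite; all monomials of \<open>A m\<close>
        other than a maximal bad \<open>m\<close> are larger and of the same degree, hence not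
        bad.\<close>
      define Bad where "Bad = {m \<in> initials le J \<inter> monomials (mdeg u). xmon m \<notin> act A ` init_ideal le J}"
      have "finite Bad"
        unfolding Bad_def by (rule finite_subset[OF _ finite_monomials[of "mdeg u"]]) auto
      moreover have "Bad \<noteq> {}"
        using that not_in by (auto simp: Bad_def monomials_def)
      ultimately have Max: "ord.Max Bad \<in> Bad" "\<And>m. m \<in> Bad \<Longrightarrow> le m (ord.Max Bad)" by auto
      define m where "m = ord.Max Bad"
      have m: "m \<in> initials le J" "mdeg m = mdeg u" "xmon m \<notin> act A ` init_ideal le J"
        using Max(1) by (auto simp: m_def Bad_def monomials_def)
      define c where "c = Poly_Mapping.lookup (act_mon A m) m"
      have "c \<noteq> 0" unfolding c_def by (rule act_mon_borel(1)[OF A])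
      define h where "h = act_mon A m - pscale c (xmon m)"
      have "act_mon A m \<in> homogeneous (mdeg u)"
        using act_homogeneous[OF xmon_homogeneous[of m], of A] by (simp add: act_xmon m(2))
      have "h \<in> act A ` init_ideal le J"
      proof (rule span[OF sub' order.refl])
        fix n assume "n \<in> Poly_Mapping.keys h"
        then have n: "n \<in> Poly_Mapping.keys (act_mon A m)" "n \<noteq> m"
          by (auto simp: h_def in_keys_iff lookup_minus lookup_xmon c_def split: if_splits)
        then have "lt m n" using act_mon_borel(2)[OF A n(1)] by (auto simp: lt_def)
        then have "n \<notin> Bad" using Max(2) ord.leD by (auto simp: m_def)
        then show "xmon n \<in> act A ` init_ideal le J"
          using n(1) stable[OF A m(1)] \<open>act_mon A m \<in> _\<close> by (auto simp: Bad_def homogeneous_def)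
      qed
      moreover have "act_mon A m \<in> act A ` init_ideal le J"
        unfolding act_xmon[symmetric] using m(1) by (intro imageI) (simp add: init xmon_def)
      ultimately have "pscale (1 / c) (act_mon A m - h) \<in> act A ` init_ideal le J"
        using sub' by (intro mp.subspace_scale mp.subspace_diff)
      then show False
        using m(3) \<open>c \<noteq> 0\<close> by (simp add: h_def)
    qed
    then show "init_ideal le J \<subseteq> act A ` init_ideal le J"
      using span[OF sub'] by (auto simp: init)
  qed
qed

end

section \<open>Maximality of the exterior monomial over the family\<close>

context graded_mon_order
begin

text \<open>Membership in \<open>U_deg\<close> makes the number of initial monomials equal to
  \<open>t_max\<close>, so the description in \<open>ext_mon\<close> has exactly one
  solution.\<close>

lemma ext_mon_U_deg:
  assumes "is_enumeration s d mon" "a \<in> U_deg s d mon e"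
  shows "ext_mon le s d mon e a \<in> std_ext_monomials le (t_max TYPE('k::field) s d mon e) e"
    and "set (ext_mon le s d mon e a) = initials le (graded_part (I_ideal s d mon (a :: nat \<times> nat \<Rightarrow> 'k)) e)"
proof -
  let ?W = "graded_part (I_ideal s d mon a) e"
  have J: "homogeneous_ideal (I_ideal s d mon a)"
    using assms(1) by (rule homogeneous_ideal_I_ideal)
  then have "mp.subspace ?W" by (simp add: homogeneous_ideal_def graded_part_subspace)
  from card_initials[OF this graded_part_homogeneous]
  have "card (initials le ?W) = t_max TYPE('k) s d mon e"
    using assms(2) by (simp add: U_deg_def hilb_def)
  from theI'[OF std_ext_monomial_exists[OF initials_homogeneous[OF graded_part_homogeneous] this]]
  show "ext_mon le s d mon e a \<in> std_ext_monomials le (t_max TYPE('k) s d mon e) e"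
    "set (ext_mon le s d mon e a) = initials le ?W"
    unfolding ext_mon_def graded_init_ideal_monomials[OF J] by blast+
qed

lemma V_deg_maximal:
  fixes a b :: "nat \<times> nat \<Rightarrow> 'k::field"
  assumes "is_enumeration s d mon" "a \<in> V_deg le s d mon e" "b \<in> U_deg s d mon e"
  shows "ext_ge le (ext_mon le s d mon e a) (ext_mon le s d mon e b)"
proof -
  let ?S = "ext_mon le s d mon e ` (U_deg s d mon e :: (nat \<times> nat \<Rightarrow> 'k) set)"
  have S: "?S \<subseteq> std_ext_monomials le (t_max TYPE('k) s d mon e) e"
    using ext_mon_U_deg(1)[OF assms(1)] by auto
  have "finite ?S" using S finite_std_ext_monomials by (rule finite_subset)
  moreover have "?S \<noteq> {}" using assms(3) by auto
  moreover have "length ms = t_max TYPE('k) s d mon e" if "ms \<in> ?S" for ms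
    using S that by (auto simp: std_ext_monomials_def)
  ultimately have "\<exists>!M. M \<in> ?S \<and> (\<forall>ms\<in>?S. ext_ge le M ms)"
    by (rule ext_ge_maximum_unique)
  then have "\<exists>!M. M \<in> ?S \<and> (\<forall>a\<in>U_deg s d mon e. ext_ge le M (ext_mon le s d mon e (a :: nat \<times> nat \<Rightarrow> 'k)))"
    by simp
  from theI'[OF this] show ?thesis
    using assms(2,3) by (simp add: V_deg_def max_ext_mon_def)
qed

end

theorem theorem2p5:
  fixes s :: nat and d :: "nat \<Rightarrow> nat"
    and le :: "('n::{finite, linorder}) monomial \<Rightarrow> 'n monomial \<Rightarrow> bool"
    and mon :: "nat \<Rightarrow> nat \<Rightarrow> 'n monomial"
    and a :: "nat \<times> nat \<Rightarrow> 'k::field"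
  assumes "infinite (UNIV :: 'k set)"
    and "s \<ge> 1"
    and "\<forall>j\<in>{1..s}. d j \<ge> 1"
    and "is_enumeration s d mon"
    and "monomial_order le"
    and "\<forall>i j. i \<le> j \<longrightarrow> le (varmon j) (varmon i)"
    and "a \<in> V_set le s d mon"
  shows "borel_fixed (init_ideal le (I_ideal s d mon a))"
proof -
  interpret borel_mon_order le
    using assms(5,6) by unfold_locales auto
  let ?J = "I_ideal s d mon a"
  have J: "homogeneous_ideal ?J"
    using assms(4) by (rule homogeneous_ideal_I_ideal)
  show ?thesis
  proof (rule initials_borel_stable_imp_borel_fixed[OF J], rule ccontr)
    fix A :: "'k ^ 'n::{finite, linorder} ^ 'n::{finite, linorder}" and u
    assume A: "A \<in> borel_group" and u: "u \<in> initials le ?J"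
      and moved: "\<not> Poly_Mapping.keys (act_mon A u) \<subseteq> initials le ?J"
    \<comment> \<open>The contradiction is sought in the degree of the moved monomial, where the
      space is finite-dimensional and maximality in \<open>V_deg\<close> applies.\<close>
    define e where "e = mdeg u"
    let ?W = "graded_part ?J e"
    have initials: "initials le ?W = initials le ?J \<inter> monomials e"
      using J by (rule initials_graded_part)
    have a: "a \<in> V_deg le s d mon e" using assms(7) by (simp add: V_set_def)
    then have U: "a \<in> U_deg s d mon e" by (simp add: V_deg_def)
    have sub: "mp.subspace ?W"
      using J by (simp add: homogeneous_ideal_def graded_part_subspace)
    have "u \<in> initials le ?W" "\<not> Poly_Mapping.keys (act_mon A u) \<subseteq> initials le ?W"
      using u moved unfolding initials by (auto simp: e_def monomials_def)
    then obtain g where g: "invertible g"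
      "\<And>ms. ms \<in> std_ext_monomials le (t_max TYPE('k) s d mon e) e \<Longrightarrow>
        set ms = initials le (act g ` ?W) \<Longrightarrow> \<not> ext_ge le (ext_mon le s d mon e a) ms"
      using exists_larger_exterior_monomial[OF assms(1) A sub graded_part_homogeneous
            ext_mon_U_deg[OF assms(4) U]] by blast
    \<comment> \<open>The transformed space belongs to another parameter point of
      \<open>U_deg\<close>, so its exterior monomial competes in \<open>max_ext_mon\<close>.\<close>
    obtain b where b: "b \<in> U_deg s d mon e" "graded_part (I_ideal s d mon b) e = act g ` ?W"
      using act_U_deg[OF assms(4) g(1) U] by blast
    have "\<not> ext_ge le (ext_mon le s d mon e a) (ext_mon le s d mon e b)"
      using ext_mon_U_deg[OF assms(4) b(1)] by (intro g(2)) (simp_all add: b(2))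
    then show False
      using V_deg_maximal[OF assms(4) a b(1)] by simp
  qed
qed

end
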